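(* Let $(M,g)$ be given by the Gibbons--Hawking construction from $(N,h)$, $u$, $A$, with $(N,h)$ real-analytic, and let $\phi:M=N\times\mathbb{R}\to N$ be the projection. Then any real-analytic soliton flow on $(M,g)$ is uniquely determined by its restriction to any local section of $\phi$; that is, if $E$ and $E'$ are real-analytic soliton flows on $(M,g)$ and there exist a nonempty open set $U\subseteq N$ and a section $s:U\to M$ of $\phi$ over $U$ such that $E_{s(p)}=E'_{s(p)}$ for all $p\in U$, then $E=E'$.
   Context: A vector field $E$ on a Riemannian manifold $(M,g)$ is a soliton flow if there is a constant $a\in\mathbb{R}$ with $\mathrm{Ric}_M+a\,g+\tfrac12\mathcal{L}_E g=0$. Gibbons--Hawking construction: $(N,h)$ is a connected oriented $3$-dimensional Riemannian manifold, $u$ is a positive function and $A$ a one-form on $N$ satisfying the monopole equation $du=*dA$ (so $u$ is harmonic), $M=N\times\mathbb{R}$ with coordinate $t$ on $\mathbb{R}$, and $g=u\,h+u^{-1}(dt+A)^2$ (with $u,h,A$ pulled back by the projection $\phi:M\to N$). Standing assumption: $dA$ (equivalently $du$) is nowhere zero. *)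

theory Defs
  imports "HOL-Analysis.Analysis"
begin

section \<open>Smooth and real-analytic maps between Euclidean spaces\<close>

primrec C_k_on :: "nat \<Rightarrow> 'a::real_normed_vector set \<Rightarrow> ('a \<Rightarrow> 'b::real_normed_vector) \<Rightarrow> bool" where
  "C_k_on 0 S f \<longleftrightarrow> continuous_on S f"
| "C_k_on (Suc k) S f \<longleftrightarrow> (\<forall>x\<in>S. f differentiable (at x)) \<and>
     (\<forall>v. C_k_on k S (\<lambda>x. frechet_derivative f (at x) v))"

text \<open>Both notions below are only meant for open \<open>S\<close>.\<close>

definition smooth_on :: "'a::real_normed_vector set \<Rightarrow> ('a \<Rightarrow> 'b::real_normed_vector) \<Rightarrow> bool" where
  "smooth_on S f \<longleftrightarrow> (\<forall>k. C_k_on k S f)"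

text \<open>Near every point of \<open>S\<close>, \<open>f\<close> is the sum of a power series; multi-indices are the functions
  \<open>Basis \<rightarrow> nat\<close>, extended by \<open>0\<close>.\<close>

definition real_analytic_on :: "'a::euclidean_space set \<Rightarrow> ('a \<Rightarrow> 'b::real_normed_vector) \<Rightarrow> bool" where
  "real_analytic_on S f \<longleftrightarrow>
     (\<forall>p\<in>S. \<exists>r>0. \<exists>a. \<forall>x\<in>ball p r.
        ((\<lambda>\<alpha>. (\<Prod>b\<in>Basis. ((x - p) \<bullet> b) ^ \<alpha> b) *\<^sub>R a \<alpha>) has_sum f x)
          {\<alpha>::'a \<Rightarrow> nat. \<forall>b. b \<notin> Basis \<longrightarrow> \<alpha> b = 0})"

section \<open>Manifolds\<close>

text \<open>A manifold is a whole type \<open>'m\<close> (Hausdorff and second countable, by its sort) with a maximal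
  smooth atlas; \<open>'e\<close> is the model space. A chart is a pair (domain, coordinate map); the values of
  the coordinate map outside the domain are irrelevant.\<close>

type_synonym ('m, 'e) chart = "'m set \<times> ('m \<Rightarrow> 'e)"

definition is_chart :: "('m::topological_space, 'e::euclidean_space) chart \<Rightarrow> bool" where
  "is_chart c \<longleftrightarrow> open (fst c) \<and> open (snd c ` fst c) \<and>
     (\<exists>\<psi>. homeomorphism (fst c) (snd c ` fst c) (snd c) \<psi>)"

definition chart_inv :: "('m, 'e) chart \<Rightarrow> 'e \<Rightarrow> 'm" where
  "chart_inv c = inv_into (fst c) (snd c)"

abbreviation chart_image :: "('m, 'e) chart \<Rightarrow> 'e set" where
  "chart_image c \<equiv> snd c ` fst c"

definition transition :: "('m, 'e) chart \<Rightarrow> ('m, 'f) chart \<Rightarrow> 'e \<Rightarrow> 'f" where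
  "transition c d = snd d \<circ> chart_inv c"

definition smooth_compatible ::
    "('m, 'e::euclidean_space) chart \<Rightarrow> ('m, 'e) chart \<Rightarrow> bool" where
  "smooth_compatible c d \<longleftrightarrow>
     smooth_on (snd c ` (fst c \<inter> fst d)) (transition c d) \<and>
     smooth_on (snd d ` (fst c \<inter> fst d)) (transition d c)"

definition smooth_structure ::
    "('m::{second_countable_topology,t2_space}, 'e::euclidean_space) chart set \<Rightarrow> bool" where
  "smooth_structure \<S> \<longleftrightarrow>
     (\<Union>c\<in>\<S>. fst c) = UNIV \<and>
     \<S> = {c. is_chart c \<and> (\<forall>d\<in>\<S>. smooth_compatible c d)}"

definition prod_chart :: "('m, 'e) chart \<Rightarrow> ('m \<times> real, 'e \<times> real) chart" where
  "prod_chart c = (fst c \<times> UNIV, \<lambda>(q, t). (snd c q, t))"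

text \<open>The maximal atlas of \<open>N \<times> \<real>\<close> generated by the product charts.\<close>

definition product_structure ::
    "('m::topological_space, 'e::euclidean_space) chart set \<Rightarrow> ('m \<times> real, 'e \<times> real) chart set" where
  "product_structure \<S> = {c. is_chart c \<and> (\<forall>d\<in>\<S>. smooth_compatible c (prod_chart d))}"

text \<open>An orientation is given by an oriented atlas contained in the smooth structure.\<close>

definition orientation :: "('m, real^3) chart set \<Rightarrow> ('m, real^3) chart set \<Rightarrow> bool" where
  "orientation \<S> \<O> \<longleftrightarrow> \<O> \<subseteq> \<S> \<and> (\<Union>c\<in>\<O>. fst c) = UNIV \<and>
     (\<forall>c\<in>\<O>. \<forall>d\<in>\<O>. \<forall>x\<in>snd c ` (fst c \<inter> fst d).
        0 < det (matrix (frechet_derivative (transition c d) (at x))))"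

definition smooth_function ::
    "('m, 'e::euclidean_space) chart set \<Rightarrow> ('m \<Rightarrow> real) \<Rightarrow> bool" where
  "smooth_function \<S> f \<longleftrightarrow> (\<forall>c\<in>\<S>. smooth_on (chart_image c) (f \<circ> chart_inv c))"

definition smooth_map_on ::
    "('m::topological_space, 'e::euclidean_space) chart set \<Rightarrow>
     ('n::topological_space, 'f::euclidean_space) chart set \<Rightarrow> 'm set \<Rightarrow> ('m \<Rightarrow> 'n) \<Rightarrow> bool" where
  "smooth_map_on \<S> \<T> U f \<longleftrightarrow> continuous_on U f \<and>
     (\<forall>c\<in>\<S>. \<forall>d\<in>\<T>. smooth_on (snd c ` (U \<inter> fst c \<inter> f -` fst d)) (snd d \<circ> f \<circ> chart_inv c))"

section \<open>Tangent vectors\<close>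

text \<open>A tangent vector at \<open>p\<close> assigns to every chart at \<open>p\<close> a vector of components, related by the
  Jacobians of the transition maps. It is \<open>0\<close> on all other pairs, so that two tangent vectors at
  \<open>p\<close> agree iff they are equal as HOL functions.\<close>

type_synonym ('m, 'e) tangent = "('m, 'e) chart \<Rightarrow> 'e"

definition tangent_space ::
    "('m, 'e::euclidean_space) chart set \<Rightarrow> 'm \<Rightarrow> ('m, 'e) tangent set" where
  "tangent_space \<S> p = {v.
     (\<forall>c\<in>\<S>. \<forall>d\<in>\<S>. p \<in> fst c \<inter> fst d \<longrightarrow>
        v d = frechet_derivative (transition c d) (at (snd c p)) (v c)) \<and>
     (\<forall>c. c \<notin> \<S> \<or> p \<notin> fst c \<longrightarrow> v c = 0)}"

text \<open>The tangent vector at \<open>p\<close> with components \<open>x\<close> in the chart \<open>c\<close>.\<close>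

definition coord_vector ::
    "('m, 'e::euclidean_space) chart set \<Rightarrow> ('m, 'e) chart \<Rightarrow> 'm \<Rightarrow> 'e \<Rightarrow> ('m, 'e) tangent" where
  "coord_vector \<S> c p x = (\<lambda>d. if d \<in> \<S> \<and> p \<in> fst d
     then frechet_derivative (transition c d) (at (snd c p)) x else 0)"

text \<open>The differential of a smooth vector-valued function, and of a smooth map between manifolds.
  By the chain rule the chosen chart at \<open>p\<close> does not matter.\<close>

definition d_fun ::
    "('m, 'e::euclidean_space) chart set \<Rightarrow> ('m \<Rightarrow> 'b::real_normed_vector) \<Rightarrow> 'm \<Rightarrow>
     ('m, 'e) tangent \<Rightarrow> 'b" where
  "d_fun \<S> f p v = (let c = (SOME c. c \<in> \<S> \<and> p \<in> fst c) in
     frechet_derivative (f \<circ> chart_inv c) (at (snd c p)) (v c))"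

definition pushforward ::
    "('m, 'e::euclidean_space) chart set \<Rightarrow> ('n, 'f::euclidean_space) chart set \<Rightarrow> ('m \<Rightarrow> 'n) \<Rightarrow> 'm \<Rightarrow>
     ('m, 'e) tangent \<Rightarrow> ('n, 'f) tangent" where
  "pushforward \<S> \<T> f p v = (\<lambda>d. if d \<in> \<T> \<and> f p \<in> fst d then d_fun \<S> (snd d \<circ> f) p v else 0)"

section \<open>Tensor fields\<close>

type_synonym ('m, 'e) vector_field = "'m \<Rightarrow> ('m, 'e) tangent"
type_synonym ('m, 'e) one_form = "'m \<Rightarrow> ('m, 'e) tangent \<Rightarrow> real"
type_synonym ('m, 'e) two_tensor = "'m \<Rightarrow> ('m, 'e) tangent \<Rightarrow> ('m, 'e) tangent \<Rightarrow> real"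

text \<open>Coordinate expressions in a chart \<open>c\<close>, as functions of \<open>x\<close> in the image of \<open>c\<close>.\<close>

definition vector_in_chart ::
    "('m, 'e) chart \<Rightarrow> ('m, 'e) vector_field \<Rightarrow> 'e \<Rightarrow> 'e" where
  "vector_in_chart c E x = E (chart_inv c x) c"

definition form_in_chart ::
    "('m, 'e::euclidean_space) chart set \<Rightarrow> ('m, 'e) chart \<Rightarrow> ('m, 'e) one_form \<Rightarrow> 'e \<Rightarrow> 'e \<Rightarrow> real" where
  "form_in_chart \<S> c A x v =
     A (chart_inv c x) (coord_vector \<S> c (chart_inv c x) v)"

definition tensor_in_chart ::
    "('m, 'e::euclidean_space) chart set \<Rightarrow> ('m, 'e) chart \<Rightarrow> ('m, 'e) two_tensor \<Rightarrow>
     'e \<Rightarrow> 'e \<Rightarrow> 'e \<Rightarrow> real" where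
  "tensor_in_chart \<S> c g x v w =
     g (chart_inv c x) (coord_vector \<S> c (chart_inv c x) v) (coord_vector \<S> c (chart_inv c x) w)"

definition smooth_vector_field ::
    "('m, 'e::euclidean_space) chart set \<Rightarrow> ('m, 'e) vector_field \<Rightarrow> bool" where
  "smooth_vector_field \<S> E \<longleftrightarrow> (\<forall>p. E p \<in> tangent_space \<S> p) \<and>
     (\<forall>c\<in>\<S>. smooth_on (chart_image c) (vector_in_chart c E))"

definition smooth_one_form ::
    "('m, 'e::euclidean_space) chart set \<Rightarrow> ('m, 'e) one_form \<Rightarrow> bool" where
  "smooth_one_form \<S> A \<longleftrightarrow> (\<forall>c\<in>\<S>.
     (\<forall>x\<in>chart_image c. linear (form_in_chart \<S> c A x)) \<and>
     (\<forall>v. smooth_on (chart_image c) (\<lambda>x. form_in_chart \<S> c A x v)))"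

definition riemannian_metric ::
    "('m, 'e::euclidean_space) chart set \<Rightarrow> ('m, 'e) two_tensor \<Rightarrow> bool" where
  "riemannian_metric \<S> g \<longleftrightarrow> (\<forall>c\<in>\<S>.
     (\<forall>x\<in>chart_image c. bilinear (tensor_in_chart \<S> c g x) \<and>
        (\<forall>v w. tensor_in_chart \<S> c g x v w = tensor_in_chart \<S> c g x w v) \<and>
        (\<forall>v. v \<noteq> 0 \<longrightarrow> 0 < tensor_in_chart \<S> c g x v v)) \<and>
     (\<forall>v w. smooth_on (chart_image c) (\<lambda>x. tensor_in_chart \<S> c g x v w)))"

section \<open>Real-analytic structures\<close>

text \<open>\<open>\<B>\<close> is a real-analytic atlas, compatible with the smooth structure \<open>\<S>\<close>, in which the metric
  \<open>g\<close> is real-analytic. Such an atlas is unique up to analytic equivalence if it exists, as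
  \<open>g\<close>-normal coordinates are then analytic.\<close>

definition real_analytic_atlas ::
    "('m, 'e::euclidean_space) chart set \<Rightarrow> ('m, 'e) two_tensor \<Rightarrow> ('m, 'e) chart set \<Rightarrow> bool" where
  "real_analytic_atlas \<S> g \<B> \<longleftrightarrow> \<B> \<subseteq> \<S> \<and> (\<Union>c\<in>\<B>. fst c) = UNIV \<and>
     (\<forall>c\<in>\<B>. \<forall>d\<in>\<B>. real_analytic_on (snd c ` (fst c \<inter> fst d)) (transition c d)) \<and>
     (\<forall>c\<in>\<B>. \<forall>v w. real_analytic_on (chart_image c) (\<lambda>x. tensor_in_chart \<S> c g x v w))"

definition real_analytic_vector_field ::
    "('m, 'e::euclidean_space) chart set \<Rightarrow> ('m, 'e) vector_field \<Rightarrow> bool" where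
  "real_analytic_vector_field \<B> E \<longleftrightarrow>
     (\<forall>c\<in>\<B>. real_analytic_on (chart_image c) (vector_in_chart c E))"

section \<open>Local tensor calculus\<close>

text \<open>Here \<open>G x\<close> is the metric, \<open>X x\<close> a vector field and \<open>\<omega> x\<close> a one-form on an open set of
  \<open>'e\<close>; the arguments \<open>v\<close>, \<open>w\<close>, \<open>z\<close> stand for constant vector fields.\<close>

text \<open>\<open>christoffel G x v w\<close> is the covariant derivative of \<open>w\<close> along \<open>v\<close>, defined by the Koszul
  formula.\<close>

definition christoffel :: "('e::euclidean_space \<Rightarrow> 'e \<Rightarrow> 'e \<Rightarrow> real) \<Rightarrow> 'e \<Rightarrow> 'e \<Rightarrow> 'e \<Rightarrow> 'e" where
  "christoffel G x v w = (THE y. \<forall>z. G x y z =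
     (frechet_derivative (\<lambda>x. G x w z) (at x) v
    + frechet_derivative (\<lambda>x. G x v z) (at x) w
    - frechet_derivative (\<lambda>x. G x v w) (at x) z) / 2)"

text \<open>\<open>R(v,w)z = \<nabla>\<^sub>v\<nabla>\<^sub>w z - \<nabla>\<^sub>w\<nabla>\<^sub>v z\<close>, and \<open>Ric(w,z)\<close> is the trace of \<open>v \<mapsto> R(v,w)z\<close>.\<close>

definition riemann :: "('e::euclidean_space \<Rightarrow> 'e \<Rightarrow> 'e \<Rightarrow> real) \<Rightarrow> 'e \<Rightarrow> 'e \<Rightarrow> 'e \<Rightarrow> 'e \<Rightarrow> 'e" where
  "riemann G x v w z =
     frechet_derivative (\<lambda>x. christoffel G x w z) (at x) v + christoffel G x v (christoffel G x w z)
   - frechet_derivative (\<lambda>x. christoffel G x v z) (at x) w - christoffel G x w (christoffel G x v z)"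

definition ricci :: "('e::euclidean_space \<Rightarrow> 'e \<Rightarrow> 'e \<Rightarrow> real) \<Rightarrow> 'e \<Rightarrow> 'e \<Rightarrow> 'e \<Rightarrow> real" where
  "ricci G x w z = (\<Sum>b\<in>Basis. riemann G x b w z \<bullet> b)"

definition lie_derivative ::
    "('e::euclidean_space \<Rightarrow> 'e) \<Rightarrow> ('e \<Rightarrow> 'e \<Rightarrow> 'e \<Rightarrow> real) \<Rightarrow> 'e \<Rightarrow> 'e \<Rightarrow> 'e \<Rightarrow> real" where
  "lie_derivative X G x v w =
     frechet_derivative (\<lambda>x. G x v w) (at x) (X x)
   + G x (frechet_derivative X (at x) v) w
   + G x v (frechet_derivative X (at x) w)"

definition ext_deriv :: "('e::euclidean_space \<Rightarrow> 'e \<Rightarrow> real) \<Rightarrow> 'e \<Rightarrow> 'e \<Rightarrow> 'e \<Rightarrow> real" where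
  "ext_deriv \<omega> x v w =
     frechet_derivative (\<lambda>x. \<omega> x w) (at x) v - frechet_derivative (\<lambda>x. \<omega> x v) (at x) w"

text \<open>The Hodge star of a two-form \<open>\<beta>\<close> on \<open>real^3\<close> with inner product \<open>H\<close> and standard orientation:
  \<open>*(e\<^sup>2\<and>e\<^sup>3) = e\<^sup>1\<close> and cyclically, for a positively oriented orthonormal frame \<open>e\<close>
  (the rows of the matrix). The result does not depend on the frame.\<close>

definition hodge_star ::
    "(real^3 \<Rightarrow> real^3 \<Rightarrow> real) \<Rightarrow> (real^3 \<Rightarrow> real^3 \<Rightarrow> real) \<Rightarrow> real^3 \<Rightarrow> real" where
  "hodge_star H \<beta> v =
     (let e = (SOME e::real^3^3. (\<forall>i j. H (e $ i) (e $ j) = (if i = j then 1 else 0)) \<and> 0 < det e)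
      in H v (e $ 1) * \<beta> (e $ 2) (e $ 3) + H v (e $ 2) * \<beta> (e $ 3) (e $ 1)
       + H v (e $ 3) * \<beta> (e $ 1) (e $ 2))"

section \<open>Soliton flows and the Gibbons--Hawking construction\<close>

definition soliton_flow ::
    "('m, 'e::euclidean_space) chart set \<Rightarrow> ('m, 'e) two_tensor \<Rightarrow> ('m, 'e) vector_field \<Rightarrow> bool" where
  "soliton_flow \<S> g E \<longleftrightarrow> smooth_vector_field \<S> E \<and>
     (\<exists>a::real. \<forall>c\<in>\<S>. \<forall>x\<in>chart_image c. \<forall>v w.
        ricci (tensor_in_chart \<S> c g) x v w + a * tensor_in_chart \<S> c g x v w
        + 1/2 * lie_derivative (vector_in_chart c E) (tensor_in_chart \<S> c g) x v w = 0)"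

text \<open>\<open>\<S>\<close> is the smooth structure and \<open>\<O>\<close> the orientation of \<open>N\<close>. The last two conjuncts are the
  monopole equation \<open>du = *dA\<close> and the standing assumption that \<open>dA\<close> has no zeros.\<close>

definition gibbons_hawking_data ::
    "('n::{second_countable_topology,t2_space}, real^3) chart set \<Rightarrow> ('n, real^3) chart set \<Rightarrow>
     ('n, real^3) two_tensor \<Rightarrow> ('n \<Rightarrow> real) \<Rightarrow> ('n, real^3) one_form \<Rightarrow> bool" where
  "gibbons_hawking_data \<S> \<O> h u A \<longleftrightarrow>
     smooth_structure \<S> \<and> connected (UNIV :: 'n set) \<and> orientation \<S> \<O> \<and>
     riemannian_metric \<S> h \<and>
     smooth_function \<S> u \<and> (\<forall>q. 0 < u q) \<and>
     smooth_one_form \<S> A \<and>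
     (\<forall>c\<in>\<O>. \<forall>x\<in>chart_image c. \<forall>v.
        frechet_derivative (u \<circ> chart_inv c) (at x) v =
        hodge_star (tensor_in_chart \<S> c h x) (ext_deriv (form_in_chart \<S> c A) x) v) \<and>
     (\<forall>c\<in>\<S>. \<forall>x\<in>chart_image c. \<exists>v w. ext_deriv (form_in_chart \<S> c A) x v w \<noteq> 0)"

text \<open>\<open>g = u h + u\<^sup>-\<^sup>1 (dt + A)\<^sup>2\<close>, where \<open>fst\<close> is the projection \<open>\<phi>\<close> and \<open>snd\<close> the coordinate \<open>t\<close>.\<close>

definition gibbons_hawking_metric ::
    "('n::topological_space, real^3) chart set \<Rightarrow> ('n, real^3) two_tensor \<Rightarrow> ('n \<Rightarrow> real) \<Rightarrow>
     ('n, real^3) one_form \<Rightarrow> ('n \<times> real, (real^3) \<times> real) two_tensor" where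
  "gibbons_hawking_metric \<S> h u A p v w =
     (let d\<phi> = pushforward (product_structure \<S>) \<S> fst p;
          \<theta> = (\<lambda>v. d_fun (product_structure \<S>) snd p v + A (fst p) (d\<phi> v))
      in u (fst p) * h (fst p) (d\<phi> v) (d\<phi> w) + inverse (u (fst p)) * (\<theta> v * \<theta> w))"

end

theory Submission
  imports Defs
begin

text \<open>The difference \<open>X = E - E'\<close> satisfies \<open>c g + 1/2 L\<^sub>X g = 0\<close> for a constant \<open>c\<close>, and it vanishes on
  the hypersurface \<open>s(U)\<close>. At a point of the hypersurface \<open>DX\<close> kills the tangent directions, which
  forces \<open>c = 0\<close>; hence \<open>X\<close> is a Killing field and \<open>DX\<close> is skew of rank at most one, so \<open>DX = 0\<close>.
  A Killing field satisfies a second-order linear system that expresses \<open>D\<^sup>2X\<close> through \<open>X\<close> and \<open>DX\<close>,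
  so by Gronwall's inequality along segments \<open>X = 0\<close> and \<open>DX = 0\<close> propagate through convex chart
  balls. The interior of \<open>{X = 0}\<close> is therefore open, closed and nonempty in the connected \<open>N \<times> \<real>\<close>.
  All computations take place in product charts, where \<open>g\<close> is explicit.\<close>

section \<open>Calculus of \<open>C\<^sup>k\<close> maps\<close>

text \<open>Codimension one is what makes the zero set decisive: a dilation vanishes at a point with
  \<open>c\<close> nonzero, and a rotation is a Killing field that vanishes in codimension two with
  \<open>DX\<close> nonzero. A skew endomorphism other than zero has rank at least two, so a
  hypersurface of zeros leaves no room for it. Instead of covariant derivatives and curvature, the
  propagation uses ordinary derivatives in a chart, and of the second-order system only the
  inequality norm(D^2 X) \<le> C (norm X + norm DX) on compact sets; neither the Christoffel symbols
  nor the Ricci tensor is ever evaluated. Second derivatives are iterated directional derivatives,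
  whose symmetry is not built in; hence the proof of Schwarz's theorem for \<open>C_k_on\<close>.
  Product charts suffice because they belong to the atlas of \<open>N \<times> \<real>\<close> and
  cover it.\<close>

lemma frechet_derivative_cong_open:
  assumes "open S" "x \<in> S" "\<And>y. y \<in> S \<Longrightarrow> f y = g y"
  shows "frechet_derivative f (at x) = frechet_derivative g (at x)"
proof -
  \<comment> \<open>\<open>frechet_derivative\<close> chooses one of the functions \<open>D\<close>
    satisfying this predicate, so equality of the predicates also settles points where no derivative
    exists.\<close>
  have "(f has_derivative D) (at x) = (g has_derivative D) (at x)" for D
    using assms by (metis has_derivative_transform_within_open)
  then show ?thesis by (simp add: frechet_derivative_def)
qed

lemma differentiable_cong_open:
  assumes "open S" "x \<in> S" "\<And>y. y \<in> S \<Longrightarrow> f y = g y" "f differentiable (at x)"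
  shows "g differentiable (at x)"
  using assms unfolding differentiable_def by (metis has_derivative_transform_within_open)

lemma frechet_derivative_linear:
  assumes "f differentiable (at x)"
  shows "linear (frechet_derivative f (at x))"
  using assms frechet_derivative_works has_derivative_linear by blast

section \<open>Closure rules for \<open>C_k_on\<close>\<close>

lemma C_k_on_cong:
  assumes "open S" "\<And>x. x \<in> S \<Longrightarrow> f x = g x"
  shows "C_k_on k S f \<longleftrightarrow> C_k_on k S g"
  using assms(2)
proof (induction k arbitrary: f g)
  case 0
  then show ?case by (simp cong: continuous_on_cong)
next
  case (Suc k)
  have "(\<forall>x\<in>S. f differentiable (at x)) \<longleftrightarrow> (\<forall>x\<in>S. g differentiable (at x))"
    using Suc.prems assms(1) by (metis differentiable_cong_open)
  moreover have "C_k_on k S (\<lambda>x. frechet_derivative f (at x) v)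
      \<longleftrightarrow> C_k_on k S (\<lambda>x. frechet_derivative g (at x) v)" for v
    using Suc.prems assms(1) by (intro Suc.IH) (metis frechet_derivative_cong_open)
  ultimately show ?case by simp
qed

text \<open>Drives the inductions on \<open>k\<close> below: a differentiation rule supplies the
  explicit derivative \<open>f'\<close>, and the induction hypothesis applies to its terms.\<close>

lemma C_k_on_SucI:
  assumes "open S" "\<And>x. x \<in> S \<Longrightarrow> (f has_derivative f' x) (at x)" "\<And>v. C_k_on k S (\<lambda>x. f' x v)"
  shows "C_k_on (Suc k) S f"
proof -
  have "C_k_on k S (\<lambda>x. frechet_derivative f (at x) v) \<longleftrightarrow> C_k_on k S (\<lambda>x. f' x v)" for v
    by (rule C_k_on_cong[OF assms(1)]) (simp add: frechet_derivative_at[OF assms(2), symmetric])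
  then show ?thesis
    using assms by (auto simp: differentiable_def)
qed

lemma C_k_on_SucD:
  assumes "C_k_on (Suc k) S f"
  shows "x \<in> S \<Longrightarrow> (f has_derivative frechet_derivative f (at x)) (at x)"
    "C_k_on k S (\<lambda>x. frechet_derivative f (at x) v)"
  using assms by (auto simp: frechet_derivative_works[symmetric])

lemma C_k_on_Suc_imp: "C_k_on (Suc k) S f \<Longrightarrow> C_k_on k S f"
proof (induction k arbitrary: f)
  case 0
  then show ?case
    by (auto intro!: differentiable_imp_continuous_on differentiable_at_imp_differentiable_on)
qed simp

lemma C_k_on_const: "C_k_on k S (\<lambda>x. c)"
  by (induction k arbitrary: c) auto

lemma C_k_on_bounded_linear:
  assumes "bounded_linear f"
  shows "C_k_on k S f"
proof (cases k)
  case 0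
  then show ?thesis using assms by (simp add: linear_continuous_on)
next
  case (Suc j)
  have d: "(f has_derivative f) (at x)" for x
    using assms by (rule bounded_linear_imp_has_derivative)
  then have "frechet_derivative f (at x) = f" for x
    using frechet_derivative_at by metis
  then show ?thesis using d Suc by (auto simp: C_k_on_const differentiable_def)
qed

lemma C_k_on_add:
  assumes "open S" "C_k_on k S f" "C_k_on k S g"
  shows "C_k_on k S (\<lambda>x. f x + g x)"
  using assms(2,3)
proof (induction k arbitrary: f g)
  case 0
  then show ?case by (simp add: continuous_on_add)
next
  case (Suc k)
  note D = C_k_on_SucD[OF Suc.prems(1)] C_k_on_SucD[OF Suc.prems(2)]
  show ?case
    by (rule C_k_on_SucI[OF assms(1) has_derivative_add[OF D(1,3)] Suc.IH[OF D(2,4)]])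
qed

lemma C_k_on_compose_linear:
  assumes "open S" "C_k_on k S f" "bounded_linear L"
  shows "C_k_on k (L -` S) (\<lambda>x. f (L x))"
  using assms(2)
proof (induction k arbitrary: f)
  case 0
  then show ?case
    using continuous_on_compose2[OF _ linear_continuous_on[OF assms(3)], of S f "L -` S"] by auto
next
  case (Suc k)
  note D = C_k_on_SucD[OF Suc.prems]
  have op: "open (L -` S)"
    using assms by (simp add: linear_continuous_on open_vimage)
  have d: "((\<lambda>x. f (L x)) has_derivative (\<lambda>v. frechet_derivative f (at (L x)) (L v))) (at x)"
    if "x \<in> L -` S" for x
    using that by (intro has_derivative_compose[OF bounded_linear_imp_has_derivative[OF assms(3)]] D) simp
  show ?case
    by (rule C_k_on_SucI[OF op d Suc.IH[OF D(2)]])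
qed

lemma C_k_on_linear_compose:
  assumes "open S" "C_k_on k S f" "bounded_linear L"
  shows "C_k_on k S (\<lambda>x. L (f x))"
  using assms(2)
proof (induction k arbitrary: f)
  case 0
  then show ?case
    using bounded_linear.continuous_on[OF assms(3)] by simp
next
  case (Suc k)
  note D = C_k_on_SucD[OF Suc.prems]
  show ?case
    by (rule C_k_on_SucI[OF assms(1) bounded_linear.has_derivative[OF assms(3) D(1)] Suc.IH[OF D(2)]])
qed

lemma C_k_on_diff:
  assumes "open S" "C_k_on k S f" "C_k_on k S g"
  shows "C_k_on k S (\<lambda>x. f x - g x)"
  using C_k_on_add[OF assms(1,2) C_k_on_linear_compose[OF assms(1,3) bounded_linear_minus[OF bounded_linear_ident]]]
  by simp

lemma C_k_on_mult:
  fixes f g :: "'a::real_normed_vector \<Rightarrow> real"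
  assumes "open S" "C_k_on k S f" "C_k_on k S g"
  shows "C_k_on k S (\<lambda>x. f x * g x)"
  using assms(2,3)
proof (induction k arbitrary: f g)
  case 0
  then show ?case by (simp add: continuous_on_mult)
next
  case (Suc k)
  have d: "((\<lambda>x. f x * g x) has_derivative
      (\<lambda>v. f x * frechet_derivative g (at x) v + frechet_derivative f (at x) v * g x)) (at x)"
    if "x \<in> S" for x
    by (rule has_derivative_mult[OF C_k_on_SucD(1)[OF Suc.prems(1) that] C_k_on_SucD(1)[OF Suc.prems(2) that]])
  have "C_k_on k S (\<lambda>x. f x * frechet_derivative g (at x) v + frechet_derivative f (at x) v * g x)" for v
    using Suc.prems C_k_on_Suc_imp[OF Suc.prems(1)] C_k_on_Suc_imp[OF Suc.prems(2)]
    by (intro C_k_on_add assms Suc.IH) auto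
  from C_k_on_SucI[OF assms(1) d this] show ?case .
qed

lemma C_k_on_inverse:
  fixes f :: "'a::real_normed_vector \<Rightarrow> real"
  assumes "open S" "C_k_on k S f" "\<And>x. x \<in> S \<Longrightarrow> f x \<noteq> 0"
  shows "C_k_on k S (\<lambda>x. inverse (f x))"
  using assms(2)
proof (induction k)
  case 0
  then show ?case using assms(3) by (simp add: continuous_on_inverse)
next
  case (Suc k)
  \<comment> \<open>The sign is written as a factor \<open>-1\<close>, so that the rules for
    products and constants cover the whole derivative.\<close>
  have d: "((\<lambda>x. inverse (f x)) has_derivative
      (\<lambda>v. (-1) * (inverse (f x) * frechet_derivative f (at x) v * inverse (f x)))) (at x)"
    if "x \<in> S" for x
    using Deriv.has_derivative_inverse[OF assms(3)[OF that] C_k_on_SucD(1)[OF Suc.prems that]] by simp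
  have "C_k_on k S (\<lambda>x. (-1) * (inverse (f x) * frechet_derivative f (at x) v * inverse (f x)))" for v
    using Suc C_k_on_Suc_imp[OF Suc.prems]
    by (intro C_k_on_mult C_k_on_const assms(1)) auto
  from C_k_on_SucI[OF assms(1) d this] show ?case .
qed

lemma C_k_on_Pair:
  fixes f :: "'a::real_normed_vector \<Rightarrow> 'b::real_normed_vector"
    and g :: "'a \<Rightarrow> 'c::real_normed_vector"
  assumes "open S" "C_k_on k S f" "C_k_on k S g"
  shows "C_k_on k S (\<lambda>x. (f x, g x))"
proof -
  have L1: "bounded_linear (\<lambda>y::'b. (y, 0::'c))" and L2: "bounded_linear (\<lambda>y::'c. (0::'b, y))"
    by (intro bounded_linear_Pair bounded_linear_ident bounded_linear_zero)+
  \<comment> \<open>A pair is the sum of two images under linear embeddings, which reduces the claim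
    to rules already available.\<close>
  have "C_k_on k S (\<lambda>x. (f x, 0) + (0, g x))"
    by (rule C_k_on_add[OF assms(1) C_k_on_linear_compose[OF assms(1,2) L1] C_k_on_linear_compose[OF assms(1,3) L2]])
  then show ?thesis by simp
qed

lemma C_k_on_fst:
  assumes "open S" "C_k_on k S f"
  shows "C_k_on k (S \<times> UNIV) (\<lambda>p. f (fst p))"
  using C_k_on_compose_linear[OF assms bounded_linear_fst] by (simp add: vimage_fst)

text \<open>The second difference of \<open>f\<close> is symmetric in \<open>v\<close> and \<open>w\<close>, which yields Schwarz's theorem.\<close>

lemma second_difference_mvt:
  fixes f :: "'a::real_normed_vector \<Rightarrow> real"
  assumes C: "C_k_on 2 S f" and s: "0 < s"
    and box: "\<And>p q. p \<in> {0..s} \<Longrightarrow> q \<in> {0..s} \<Longrightarrow> x + p *\<^sub>R v + q *\<^sub>R w \<in> S"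
  obtains p q where "p \<in> {0..s}" "q \<in> {0..s}"
    "f (x + s *\<^sub>R v + s *\<^sub>R w) - f (x + s *\<^sub>R v) - f (x + s *\<^sub>R w) + f x
      = s\<^sup>2 * frechet_derivative (\<lambda>y. frechet_derivative f (at y) v) (at (x + p *\<^sub>R v + q *\<^sub>R w)) w"
proof -
  let ?Dv = "\<lambda>y. frechet_derivative f (at y) v"
  have C': "\<forall>y\<in>S. f differentiable (at y)" "\<forall>y\<in>S. ?Dv differentiable (at y)"
    using C by (auto simp: numeral_2_eq_2)
  have chain: "((\<lambda>t. h (a + t *\<^sub>R b)) has_real_derivative frechet_derivative h (at (a + t *\<^sub>R b)) b) (at t)"
    if "h differentiable (at (a + t *\<^sub>R b))" for h :: "'a \<Rightarrow> real" and a b t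
  proof -
    have h: "(h has_derivative frechet_derivative h (at (a + t *\<^sub>R b))) (at (a + t *\<^sub>R b))"
      using that frechet_derivative_works by blast
    have "((\<lambda>t. h (a + t *\<^sub>R b)) has_derivative (\<lambda>r. frechet_derivative h (at (a + t *\<^sub>R b)) (r *\<^sub>R b))) (at t)"
      by (rule has_derivative_compose[where f="\<lambda>t. a + t *\<^sub>R b" and x=t, OF _ h])
        (auto intro!: derivative_eq_intros)
    then show ?thesis
      using linear_scale[OF frechet_derivative_linear[OF that]]
      by (simp add: has_field_derivative_def mult_commute_abs)
  qed
  \<comment> \<open>The second difference is the increment over [0, s] of t -> f (x + s w + t v) - f
    (x + t v). One mean value step in direction \<open>v\<close> gives a factor \<open>s\<close> and
    a difference of \<open>?Dv\<close>; a second one in direction \<open>w\<close> gives the other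
    factor. The terms \<open>0 *\<^sub>R v\<close> and \<open>s - 0\<close> keep the shape of
    \<open>MVT2\<close>.\<close>
  have "\<exists>p. 0 < p \<and> p < s \<and>
      (f ((x + s *\<^sub>R w) + s *\<^sub>R v) - f (x + s *\<^sub>R v)) - (f ((x + s *\<^sub>R w) + 0 *\<^sub>R v) - f (x + 0 *\<^sub>R v))
      = (s - 0) * (?Dv ((x + s *\<^sub>R w) + p *\<^sub>R v) - ?Dv (x + p *\<^sub>R v))"
  proof (rule MVT2)
    fix t assume t: "0 \<le> t" "t \<le> s"
    have "(x + s *\<^sub>R w) + t *\<^sub>R v \<in> S" "x + t *\<^sub>R v \<in> S"
      using box[of t s] box[of t 0] t s by (auto simp: algebra_simps)
    then show "((\<lambda>t. f ((x + s *\<^sub>R w) + t *\<^sub>R v) - f (x + t *\<^sub>R v)) has_real_derivative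
        ?Dv ((x + s *\<^sub>R w) + t *\<^sub>R v) - ?Dv (x + t *\<^sub>R v)) (at t)"
      using C' by (intro DERIV_diff chain) auto
  qed (use s in auto)
  then obtain p where p: "0 < p" "p < s"
    and p_eq: "f ((x + s *\<^sub>R w) + s *\<^sub>R v) - f (x + s *\<^sub>R v) - (f (x + s *\<^sub>R w) - f x)
      = s * (?Dv ((x + s *\<^sub>R w) + p *\<^sub>R v) - ?Dv (x + p *\<^sub>R v))"
    by auto
  have "\<exists>q. 0 < q \<and> q < s \<and>
      ?Dv ((x + p *\<^sub>R v) + s *\<^sub>R w) - ?Dv ((x + p *\<^sub>R v) + 0 *\<^sub>R w)
      = (s - 0) * frechet_derivative ?Dv (at ((x + p *\<^sub>R v) + q *\<^sub>R w)) w"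
  proof (rule MVT2)
    fix t assume "0 \<le> t" "t \<le> s"
    then show "((\<lambda>t. ?Dv ((x + p *\<^sub>R v) + t *\<^sub>R w)) has_real_derivative
        frechet_derivative ?Dv (at ((x + p *\<^sub>R v) + t *\<^sub>R w)) w) (at t)"
      using C' p box by (intro chain) auto
  qed (use s in auto)
  then obtain q where q: "0 < q" "q < s"
    and q_eq: "?Dv ((x + p *\<^sub>R v) + s *\<^sub>R w) - ?Dv (x + p *\<^sub>R v)
      = s * frechet_derivative ?Dv (at ((x + p *\<^sub>R v) + q *\<^sub>R w)) w"
    by auto
  show thesis
    using p q p_eq q_eq by (intro that[of p q]) (auto simp: algebra_simps power2_eq_square)
qed

lemma symmetric_second_derivative_real:
  fixes f :: "'a::real_normed_vector \<Rightarrow> real"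
  assumes "open S" and C: "C_k_on 2 S f" and "x \<in> S"
  shows "frechet_derivative (\<lambda>y. frechet_derivative f (at y) v) (at x) w
       = frechet_derivative (\<lambda>y. frechet_derivative f (at y) w) (at x) v" (is "?A v w x = ?A w v x")
proof -
  have cont: "\<exists>d>0. \<forall>y. dist y x < d \<longrightarrow> y \<in> S \<and> \<bar>?A v w y - ?A v w x\<bar> < e" if "e > 0" for e v w
  proof -
    have "continuous_on S (?A v w)"
      using C by (auto simp: numeral_2_eq_2)
    then have "(?A v w \<longlongrightarrow> ?A v w x) (at x)"
      using assms by (simp add: continuous_on_eq_continuous_at isCont_def)
    then have "eventually (\<lambda>y. dist (?A v w y) (?A v w x) < e) (nhds x)"
      using that tendstoD by (fastforce simp: eventually_at_filter elim: eventually_mono)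
    moreover have "eventually (\<lambda>y. y \<in> S) (nhds x)"
      using assms by (simp add: eventually_nhds_in_open)
    ultimately have "eventually (\<lambda>y. y \<in> S \<and> dist (?A v w y) (?A v w x) < e) (nhds x)"
      by eventually_elim simp
    then show ?thesis by (auto simp: eventually_nhds_metric dist_real_def)
  qed
  have "\<bar>?A v w x - ?A w v x\<bar> \<le> e" if "e > 0" for e
  proof -
    obtain d1 d2 where d: "d1 > 0" "d2 > 0"
      and d1: "\<And>y. dist y x < d1 \<Longrightarrow> y \<in> S \<and> \<bar>?A v w y - ?A v w x\<bar> < e / 2"
      and d2: "\<And>y. dist y x < d2 \<Longrightarrow> y \<in> S \<and> \<bar>?A w v y - ?A w v x\<bar> < e / 2"
      using cont[of "e/2" v w] cont[of "e/2" w v] \<open>e > 0\<close> by (metis half_gt_zero)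
    \<comment> \<open>So small that the parallelogram spanned by \<open>s *\<^sub>R v\<close> and
      \<open>s *\<^sub>R w\<close> at \<open>x\<close> stays within distance
      \<open>min d1 d2\<close>. The \<open>+ 1\<close> covers \<open>v = w = 0\<close> and makes the
      bound strict.\<close>
    define s where "s = min d1 d2 / (2 * (norm v + norm w + 1))"
    have pos: "norm v + norm w + 1 > 0"
      by (simp add: add_nonneg_pos)
    then have s: "s > 0" using d by (simp add: s_def)
    have near: "dist (x + p *\<^sub>R v + q *\<^sub>R w) x < min d1 d2" if "p \<in> {0..s}" "q \<in> {0..s}" for p q
    proof -
      have "dist (x + p *\<^sub>R v + q *\<^sub>R w) x \<le> norm (p *\<^sub>R v) + norm (q *\<^sub>R w)"
        using norm_triangle_ineq[of "p *\<^sub>R v" "q *\<^sub>R w"] by (simp add: dist_norm algebra_simps)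
      also have "\<dots> \<le> s * norm v + s * norm w"
        using that by (auto intro!: add_mono mult_right_mono)
      also have "\<dots> < s * (2 * (norm v + norm w + 1))"
        using s by (simp add: algebra_simps add_strict_increasing2)
      also have "\<dots> = min d1 d2"
        by (rule nonzero_eq_divide_eq[THEN iffD1, OF _ s_def]) (use pos in simp)
      finally show ?thesis .
    qed
    have near': "dist (x + p *\<^sub>R w + q *\<^sub>R v) x < min d1 d2" if "p \<in> {0..s}" "q \<in> {0..s}" for p q
      using near[OF that(2,1)] by (simp add: algebra_simps)
    obtain p q where pq: "p \<in> {0..s}" "q \<in> {0..s}"
      "f (x + s *\<^sub>R v + s *\<^sub>R w) - f (x + s *\<^sub>R v) - f (x + s *\<^sub>R w) + f x
        = s\<^sup>2 * ?A v w (x + p *\<^sub>R v + q *\<^sub>R w)"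
      using second_difference_mvt[OF C s, of x v w] near d1
      by (metis (no_types, lifting) min_less_iff_conj)
    obtain p' q' where pq': "p' \<in> {0..s}" "q' \<in> {0..s}"
      "f (x + s *\<^sub>R w + s *\<^sub>R v) - f (x + s *\<^sub>R w) - f (x + s *\<^sub>R v) + f x
        = s\<^sup>2 * ?A w v (x + p' *\<^sub>R w + q' *\<^sub>R v)"
      using second_difference_mvt[OF C s, of x w v] near' d1
      by (metis (no_types, lifting) min_less_iff_conj)
    \<comment> \<open>Both sides are the same second difference, read in the two orders. The mixed
      derivatives thus agree at two possibly different points near \<open>x\<close>, and continuity
      brings both to \<open>x\<close>.\<close>
    have "s\<^sup>2 * ?A v w (x + p *\<^sub>R v + q *\<^sub>R w) = s\<^sup>2 * ?A w v (x + p' *\<^sub>R w + q' *\<^sub>R v)"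
      using pq(3) pq'(3) by (simp add: algebra_simps)
    then have "?A v w (x + p *\<^sub>R v + q *\<^sub>R w) = ?A w v (x + p' *\<^sub>R w + q' *\<^sub>R v)"
      using s by simp
    moreover have "\<bar>?A v w (x + p *\<^sub>R v + q *\<^sub>R w) - ?A v w x\<bar> < e / 2"
      using d1 near[OF pq(1,2)] by simp
    moreover have "\<bar>?A w v (x + p' *\<^sub>R w + q' *\<^sub>R v) - ?A w v x\<bar> < e / 2"
      using d2 near'[OF pq'(1,2)] by simp
    ultimately show ?thesis by linarith
  qed
  then show ?thesis
    by (metis abs_le_zero_iff dense_le_bounded field_le_epsilon add_0 eq_iff_diff_eq_0)
qed

lemma symmetric_second_derivative:
  fixes f :: "'a::real_normed_vector \<Rightarrow> 'b::euclidean_space"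
  assumes "open S" and C: "C_k_on 2 S f" and "x \<in> S"
  shows "frechet_derivative (\<lambda>y. frechet_derivative f (at y) v) (at x) w
       = frechet_derivative (\<lambda>y. frechet_derivative f (at y) w) (at x) v"
proof (rule euclidean_eqI)
  fix b :: 'b
  assume "b \<in> Basis"
  have comp: "frechet_derivative (\<lambda>y. h y \<bullet> b) (at y) v = frechet_derivative h (at y) v \<bullet> b"
    if "h differentiable (at y)" for h :: "'a \<Rightarrow> 'b" and y v
    using frechet_derivative_at[OF has_derivative_inner_left[OF that[unfolded frechet_derivative_works]], of b]
    by metis
  have Cb: "C_k_on 2 S (\<lambda>y. f y \<bullet> b)"
    using C_k_on_linear_compose[OF assms(1) C bounded_linear_inner_left] .
  have D: "\<And>y. y \<in> S \<Longrightarrow> f differentiable (at y)"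
    "\<And>v. (\<lambda>y. frechet_derivative f (at y) v) differentiable (at x)"
    using C \<open>x \<in> S\<close> by (auto simp: numeral_2_eq_2)
  have "frechet_derivative (\<lambda>y. frechet_derivative (\<lambda>y. f y \<bullet> b) (at y) v) (at x) w
      = frechet_derivative (\<lambda>y. frechet_derivative f (at y) v) (at x) w \<bullet> b" for v w
    using frechet_derivative_cong_open[OF assms(1,3), of "\<lambda>y. frechet_derivative (\<lambda>y. f y \<bullet> b) (at y) v"
        "\<lambda>y. frechet_derivative f (at y) v \<bullet> b"] comp D
    by simp
  then show "frechet_derivative (\<lambda>y. frechet_derivative f (at y) v) (at x) w \<bullet> b
      = frechet_derivative (\<lambda>y. frechet_derivative f (at y) w) (at x) v \<bullet> b"
    using symmetric_second_derivative_real[OF assms(1) Cb assms(3)] by metis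
qed

section \<open>Killing and homothetic fields in a chart\<close>

lemma lie_derivative_diff:
  assumes "X differentiable (at x)" "Y differentiable (at x)"
    and "(\<lambda>x. G x v w) differentiable (at x)" "bilinear (G x)"
  shows "lie_derivative (\<lambda>x. X x - Y x) G x v w = lie_derivative X G x v w - lie_derivative Y G x v w"
proof -
  have "frechet_derivative (\<lambda>x. X x - Y x) (at x) v = frechet_derivative X (at x) v - frechet_derivative Y (at x) v"
    for v
    using frechet_derivative_at[OF has_derivative_diff[OF assms(1,2)[unfolded frechet_derivative_works]]]
    by metis
  then show ?thesis
    using linear_diff[OF frechet_derivative_linear[OF assms(3)]] bilinear_lsub[OF assms(4)] bilinear_rsub[OF assms(4)]
    by (simp add: lie_derivative_def)
qed

text \<open>The differential inequality makes \<open>\<phi> t * exp (- C * t)\<close> nonincreasing,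
  and this function starts at 0. In the application \<open>\<phi>\<close> is a sum of squares, so
  the upper bound forces it to vanish.\<close>

lemma gronwall_zero:
  fixes \<phi> :: "real \<Rightarrow> real"
  assumes d: "\<And>t. 0 \<le> t \<Longrightarrow> t \<le> 1 \<Longrightarrow> (\<phi> has_real_derivative \<phi>' t) (at t)"
    and le: "\<And>t. 0 \<le> t \<Longrightarrow> t \<le> 1 \<Longrightarrow> \<phi>' t \<le> C * \<phi> t"
    and "\<phi> 0 = 0"
  shows "\<phi> 1 \<le> 0"
proof -
  have "\<phi> 1 * exp (- C * 1) \<le> \<phi> 0 * exp (- C * 0)"
  proof (rule DERIV_nonpos_imp_nonincreasing[of 0 1 "\<lambda>t. \<phi> t * exp (- C * t)"])
    fix t :: real assume t: "0 \<le> t" "t \<le> 1"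
    have "((\<lambda>t. \<phi> t * exp (- C * t)) has_real_derivative (\<phi>' t - C * \<phi> t) * exp (- C * t)) (at t)"
      using d[OF t] by (auto intro!: derivative_eq_intros simp: algebra_simps)
    moreover have "(\<phi>' t - C * \<phi> t) * exp (- C * t) \<le> 0"
      using le[OF t] by (simp add: mult_nonpos_nonneg)
    ultimately show "\<exists>y. ((\<lambda>t. \<phi> t * exp (- C * t)) has_real_derivative y) (at t) \<and> y \<le> 0"
      by blast
  qed simp
  then show ?thesis
    using assms(3) by (simp add: mult_le_0_iff)
qed

text \<open>Smoothness of a metric is known only for constant arguments. Expanding an argument that
  varies with the point leaves scalar products of functions, to which the product rule and
  continuity rules apply.\<close>

lemma bilinear_expand_left:
  fixes B :: "'e::euclidean_space \<Rightarrow> 'f::real_vector \<Rightarrow> real"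
  assumes "bilinear B"
  shows "B v w = (\<Sum>i\<in>Basis. (v \<bullet> i) * B i w)"
proof -
  have lin: "linear (\<lambda>v. B v w)"
    using assms by (simp add: bilinear_def)
  have "B v w = B (\<Sum>i\<in>Basis. (v \<bullet> i) *\<^sub>R i) w"
    by (simp add: euclidean_representation)
  then show ?thesis
    using linear_sum[OF lin, of "\<lambda>i. (v \<bullet> i) *\<^sub>R i" Basis] linear_scale[OF lin] by simp
qed

lemma norm_linear_le_sum_Basis:
  fixes f :: "'e::euclidean_space \<Rightarrow> 'f::real_normed_vector"
  assumes "linear f" "\<And>b. b \<in> Basis \<Longrightarrow> norm (f b) \<le> M"
  shows "norm (f v) \<le> (\<Sum>b\<in>Basis. \<bar>v \<bullet> b\<bar>) * M"
proof -
  have "f v = (\<Sum>b\<in>Basis. (v \<bullet> b) *\<^sub>R f b)"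
    using linear_sum[OF assms(1), of "\<lambda>b. (v \<bullet> b) *\<^sub>R b" Basis]
    by (simp add: euclidean_representation linear_scale[OF assms(1)])
  then have "norm (f v) \<le> (\<Sum>b\<in>Basis. \<bar>v \<bullet> b\<bar> * norm (f b))"
    using norm_sum[of "\<lambda>b. (v \<bullet> b) *\<^sub>R f b" Basis] by simp
  also have "\<dots> \<le> (\<Sum>b\<in>Basis. \<bar>v \<bullet> b\<bar> * M)"
    by (intro sum_mono mult_left_mono assms(2)) auto
  finally show ?thesis by (simp add: sum_distrib_right)
qed

text \<open>Nondegeneracy made uniform: the sum on the right is continuous and positive on the
  compact set \<open>K \<times> sphere 0 1\<close>, its minimum there serves as
  \<open>\<mu>\<close>, and homogeneity in \<open>v\<close> does the rest. It turns bounds on the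
  pairings of a vector with the basis into a bound on its norm.\<close>

lemma metric_lower_bound:
  fixes G :: "'e::euclidean_space \<Rightarrow> 'e \<Rightarrow> 'e \<Rightarrow> real"
  assumes "compact K" "K \<noteq> {}"
    and bil: "\<And>x. x \<in> K \<Longrightarrow> bilinear (G x)"
    and pos: "\<And>x v. x \<in> K \<Longrightarrow> v \<noteq> 0 \<Longrightarrow> 0 < G x v v"
    and cont: "\<And>v w. continuous_on K (\<lambda>x. G x v w)"
  obtains \<mu> where "0 < \<mu>" "\<And>x v. x \<in> K \<Longrightarrow> \<mu> * norm v \<le> (\<Sum>w\<in>Basis. \<bar>G x v w\<bar>)"
proof -
  \<comment> \<open>The expanded form makes joint continuity in \<open>x\<close> and
    \<open>v\<close> follow from continuity of the coefficients \<open>G x i w\<close> in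
    \<open>x\<close> alone.\<close>
  define f where "f = (\<lambda>(x, v). \<Sum>w\<in>Basis. \<bar>\<Sum>i\<in>Basis. (v \<bullet> i) * G x i w\<bar>)"
  have f: "f (x, v) = (\<Sum>w\<in>Basis. \<bar>G x v w\<bar>)" if "x \<in> K" for x v
    by (simp add: f_def flip: bilinear_expand_left[OF bil[OF that], of v])
  have contG: "continuous_on (K \<times> sphere 0 1) (\<lambda>p :: 'e \<times> 'e. G (fst p) v w)" for v w
    by (rule continuous_on_compose2[OF cont continuous_on_fst[OF continuous_on_id]]) auto
  have contf: "continuous_on (K \<times> sphere 0 1) f"
    unfolding f_def case_prod_beta by (intro continuous_intros contG)
  have "K \<times> sphere (0::'e) 1 \<noteq> {}"
    using assms(2) by simp
  then obtain p where p: "p \<in> K \<times> sphere 0 1" "\<And>q. q \<in> K \<times> sphere 0 1 \<Longrightarrow> f p \<le> f q"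
    using continuous_attains_inf[OF compact_Times[OF assms(1) compact_sphere] _ contf] by blast
  obtain x0 v0 where [simp]: "p = (x0, v0)" by (cases p)
  have x0: "x0 \<in> K" and v0: "v0 \<noteq> 0" using p by auto
  have "\<exists>w\<in>Basis. G x0 v0 w \<noteq> 0"
  proof (rule ccontr)
    assume "\<not> ?thesis"
    then have zero: "G x0 v0 w = 0" if "w \<in> Basis" for w
      using that by blast
    have lin: "linear (G x0 v0)"
      using bil[OF x0] by (simp add: bilinear_def)
    have "norm (G x0 v0 v0) \<le> (\<Sum>b\<in>Basis. \<bar>v0 \<bullet> b\<bar>) * 0"
      by (rule norm_linear_le_sum_Basis[OF lin]) (simp add: zero)
    then show False using pos[OF x0 v0] by simp
  qed
  then have "f p > 0"
    by (auto simp: f[OF x0] intro: sum_pos2)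
  moreover have "f p * norm v \<le> (\<Sum>w\<in>Basis. \<bar>G x v w\<bar>)" if x: "x \<in> K" for x v
  proof (cases "v = 0")
    case True
    then show ?thesis by (simp add: sum_nonneg)
  next
    case False
    have lin: "linear (\<lambda>v. G x v w)" for w
      using bil[OF x] by (simp add: bilinear_def)
    have "f p \<le> f (x, v /\<^sub>R norm v)"
      using x False by (intro p) auto
    also have "\<dots> = (\<Sum>w\<in>Basis. \<bar>G x v w\<bar>) / norm v"
      using linear_scale[OF lin]
      by (simp add: f[OF x] abs_mult divide_inverse sum_distrib_left mult.commute)
    finally show ?thesis
      using False by (simp add: field_simps)
  qed
  ultimately show ?thesis by (rule that)
qed

text \<open>The derivative of the Killing equation expresses the part of \<open>D\<^sup>2X\<close> symmetric in \<open>v, w\<close>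
  through \<open>X\<close> and \<open>DX\<close>.\<close>

lemma killing_derivative_bound:
  fixes G :: "'e::euclidean_space \<Rightarrow> 'e \<Rightarrow> 'e \<Rightarrow> real" and X :: "'e \<Rightarrow> 'e"
  defines "M \<equiv> \<lambda>x. norm (X x) + (\<Sum>b\<in>Basis. norm (frechet_derivative X (at x) b))"
  assumes "open S" "compact K" "K \<subseteq> S"
    and bil: "\<And>x. x \<in> S \<Longrightarrow> bilinear (G x)"
    and sym: "\<And>x v w. x \<in> S \<Longrightarrow> G x v w = G x w v"
    and CG: "\<And>v w. C_k_on 2 S (\<lambda>x. G x v w)"
    and CX: "C_k_on 2 S X"
    and kill: "\<And>x v w. x \<in> S \<Longrightarrow> lie_derivative X G x v w = 0"
    and basis: "z \<in> Basis" "v \<in> Basis" "w \<in> Basis"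
  shows "\<exists>C\<ge>0. \<forall>x\<in>K.
    \<bar>G x (frechet_derivative (\<lambda>y. frechet_derivative X (at y) v) (at x) z) w
    + G x (frechet_derivative (\<lambda>y. frechet_derivative X (at y) w) (at x) z) v\<bar> \<le> C * M x"
proof -
  define DX where "DX v x = frechet_derivative X (at x) v" for v x
  define D2X where "D2X v x z = frechet_derivative (DX v) (at x) z" for v x z
  define a where "a i x = frechet_derivative (\<lambda>x. G x v w) (at x) i" for i x
  define Da where "Da i x z = frechet_derivative (a i) (at x) z" for i x z
  define g where "g v w x = G x v w" for v w x
  define Dg where "Dg v w x z = frechet_derivative (g v w) (at x) z" for v w x z
  have C1X: "C_k_on 1 S (DX v)" for v
    using CX by (simp add: numeral_2_eq_2 DX_def[abs_def])
  have C1a: "C_k_on 1 S (a i)" for i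
    using CG[of v w] by (simp add: numeral_2_eq_2 a_def[abs_def])
  have C1g: "C_k_on 1 S (g v w)" for v w
    unfolding g_def using CG[of v w] C_k_on_Suc_imp[of 1 S "\<lambda>x. G x v w"]
    by (simp add: numeral_2_eq_2 del: C_k_on.simps)
  have dX: "(X has_derivative (\<lambda>v. DX v x)) (at x)" if "x \<in> S" for x
    using C_k_on_SucD(1)[of 1 S X x] CX that by (simp add: numeral_2_eq_2 DX_def[abs_def])
  have dDX: "(DX v has_derivative D2X v x) (at x)" if "x \<in> S" for v x
    using C_k_on_SucD(1)[of 0 S "DX v" x] C1X that by (simp add: D2X_def[abs_def])
  have da: "(a i has_derivative Da i x) (at x)" if "x \<in> S" for i x
    using C_k_on_SucD(1)[of 0 S "a i" x] C1a that by (simp add: Da_def[abs_def])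
  have dg: "(g v w has_derivative Dg v w x) (at x)" if "x \<in> S" for v w x
    using C_k_on_SucD(1)[of 0 S "g v w" x] C1g that by (simp add: Dg_def[abs_def])
  \<comment> \<open>The Lie derivative with every argument that depends on \<open>x\<close> expanded
    over the basis. It vanishes on the open set \<open>S\<close>, hence so does its derivative in
    direction \<open>z\<close>; there the terms with \<open>D2X\<close> are isolated.\<close>
  define L where "L x = (\<Sum>i\<in>Basis. (X x \<bullet> i) * a i x + (DX v x \<bullet> i) * g i w x + (DX w x \<bullet> i) * g i v x)"
    for x
  have L0: "L x = 0" if x: "x \<in> S" for x
  proof -
    have lin: "linear (frechet_derivative (\<lambda>x. G x v w) (at x))"
      using dg[OF x, of v w] unfolding g_def by (intro frechet_derivative_linear) (auto simp: differentiable_def)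
    have "frechet_derivative (\<lambda>x. G x v w) (at x) (X x) = (\<Sum>i\<in>Basis. (X x \<bullet> i) * a i x)"
      using linear_sum[OF lin, of "\<lambda>i. (X x \<bullet> i) *\<^sub>R i" Basis] linear_scale[OF lin]
      by (simp add: euclidean_representation a_def)
    then have "L x = lie_derivative X G x v w"
      using bilinear_expand_left[OF bil[OF x], of "DX v x" w] bilinear_expand_left[OF bil[OF x], of "DX w x" v]
        sym[OF x, of v "DX w x"]
      by (simp add: L_def lie_derivative_def sum.distrib g_def DX_def)
    then show ?thesis using kill[OF x] by simp
  qed
  \<comment> \<open>Each term without \<open>D2X\<close> is a component of \<open>X\<close> or of
    \<open>DX\<close> at a basis vector, hence at most \<open>M x\<close>, times one of these four
    coefficients. They are continuous, so \<open>c\<close> is bounded on the compact set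
    \<open>K\<close>.\<close>
  define c where "c x = (\<Sum>i\<in>Basis. \<bar>a i x\<bar> + \<bar>Da i x z\<bar> + \<bar>Dg i w x z\<bar> + \<bar>Dg i v x z\<bar>)" for x
  have "continuous_on S (a i)" "continuous_on S (\<lambda>x. Da i x z)" "continuous_on S (\<lambda>x. Dg i v x z)" for i v
    using C1a[of i] C1g[of i v] C_k_on_Suc_imp[of 0 S "a i"] by (auto simp: Da_def Dg_def)
  then have "continuous_on K (a i)" "continuous_on K (\<lambda>x. Da i x z)" "continuous_on K (\<lambda>x. Dg i v x z)" for i v
    using assms(4) continuous_on_subset by blast+
  then have "continuous_on K c"
    unfolding c_def by (intro continuous_intros)
  then have "bounded (c ` K)"
    using assms(3) compact_continuous_image compact_imp_bounded by blast
  then obtain C where C: "C > 0" "\<And>x. x \<in> K \<Longrightarrow> \<bar>c x\<bar> \<le> C"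
    by (auto simp: bounded_pos)
  have "\<bar>G x (D2X v x z) w + G x (D2X w x z) v\<bar> \<le> C * M x" if xK: "x \<in> K" for x
  proof -
    have x: "x \<in> S" using xK assms(4) by blast
    have "(L has_derivative (\<lambda>z. \<Sum>i\<in>Basis.
        ((X x \<bullet> i) * Da i x z + (DX z x \<bullet> i) * a i x)
      + ((DX v x \<bullet> i) * Dg i w x z + (D2X v x z \<bullet> i) * g i w x)
      + ((DX w x \<bullet> i) * Dg i v x z + (D2X w x z \<bullet> i) * g i v x))) (at x)"
      unfolding L_def
      by (intro has_derivative_sum has_derivative_add has_derivative_mult has_derivative_inner_left
          dX dDX da dg x)
    moreover have "(L has_derivative (\<lambda>z. 0)) (at x)"
      by (rule has_derivative_transform_within_open[OF has_derivative_const[of 0] assms(2) x]) (simp add: L0)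
    ultimately have "(\<Sum>i\<in>Basis.
        ((X x \<bullet> i) * Da i x z + (DX z x \<bullet> i) * a i x)
      + ((DX v x \<bullet> i) * Dg i w x z + (D2X v x z \<bullet> i) * g i w x)
      + ((DX w x \<bullet> i) * Dg i v x z + (D2X w x z \<bullet> i) * g i v x)) = 0"
      using has_derivative_unique by (metis (no_types, lifting))
    moreover have "G x (D2X v x z) w = (\<Sum>i\<in>Basis. (D2X v x z \<bullet> i) * g i w x)"
      "G x (D2X w x z) v = (\<Sum>i\<in>Basis. (D2X w x z \<bullet> i) * g i v x)"
      unfolding g_def by (rule bilinear_expand_left[OF bil[OF x]])+
    ultimately have "G x (D2X v x z) w + G x (D2X w x z) v
        = - (\<Sum>i\<in>Basis. (X x \<bullet> i) * Da i x z + (DX z x \<bullet> i) * a i x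
              + (DX v x \<bullet> i) * Dg i w x z + (DX w x \<bullet> i) * Dg i v x z)"
      by (simp add: sum.distrib)
    then have "\<bar>G x (D2X v x z) w + G x (D2X w x z) v\<bar>
        = \<bar>\<Sum>i\<in>Basis. (X x \<bullet> i) * Da i x z + (DX z x \<bullet> i) * a i x
              + (DX v x \<bullet> i) * Dg i w x z + (DX w x \<bullet> i) * Dg i v x z\<bar>"
      by (simp only: abs_minus_cancel)
    also have "\<dots> \<le> (\<Sum>i\<in>Basis. \<bar>(X x \<bullet> i) * Da i x z + (DX z x \<bullet> i) * a i x
              + (DX v x \<bullet> i) * Dg i w x z + (DX w x \<bullet> i) * Dg i v x z\<bar>)"
      by (rule sum_abs)
    also have "\<dots> \<le> (\<Sum>i\<in>Basis. M x * (\<bar>a i x\<bar> + \<bar>Da i x z\<bar> + \<bar>Dg i w x z\<bar> + \<bar>Dg i v x z\<bar>))"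
    proof (rule sum_mono)
      fix i :: 'e assume i: "i \<in> Basis"
      have le: "\<bar>Y \<bullet> i\<bar> \<le> M x" if "norm Y \<le> M x" for Y
        using Basis_le_norm[OF i, of Y] that by linarith
      have DXle: "norm (DX b x) \<le> M x" if "b \<in> Basis" for b
        unfolding M_def DX_def
        by (rule add_increasing) (use that in \<open>auto intro: member_le_sum\<close>)
      have Xle: "norm (X x) \<le> M x"
        by (simp add: M_def sum_nonneg)
      have "\<bar>(X x \<bullet> i) * Da i x z\<bar> \<le> M x * \<bar>Da i x z\<bar>" "\<bar>(DX z x \<bullet> i) * a i x\<bar> \<le> M x * \<bar>a i x\<bar>"
        "\<bar>(DX v x \<bullet> i) * Dg i w x z\<bar> \<le> M x * \<bar>Dg i w x z\<bar>"
        "\<bar>(DX w x \<bullet> i) * Dg i v x z\<bar> \<le> M x * \<bar>Dg i v x z\<bar>"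
        unfolding abs_mult by (intro mult_right_mono le Xle DXle basis abs_ge_zero)+
      then show "\<bar>(X x \<bullet> i) * Da i x z + (DX z x \<bullet> i) * a i x
              + (DX v x \<bullet> i) * Dg i w x z + (DX w x \<bullet> i) * Dg i v x z\<bar>
          \<le> M x * (\<bar>a i x\<bar> + \<bar>Da i x z\<bar> + \<bar>Dg i w x z\<bar> + \<bar>Dg i v x z\<bar>)"
        unfolding distrib_left by linarith
    qed
    also have "\<dots> = M x * c x"
      by (simp add: c_def sum_distrib_left)
    also have "\<dots> \<le> M x * C"
      using C(2)[OF xK] by (intro mult_left_mono) (auto simp: M_def sum_nonneg)
    finally show ?thesis by (simp add: mult.commute)
  qed
  then show ?thesis
    using C(1) unfolding D2X_def DX_def by (metis less_imp_le)
qed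

text \<open>As \<open>D\<^sup>2X\<close> is symmetric, its part symmetric in the last two slots determines it, in the same way
  as the Koszul formula determines the Levi-Civita connection.\<close>

lemma killing_second_derivative_bound:
  fixes G :: "'e::euclidean_space \<Rightarrow> 'e \<Rightarrow> 'e \<Rightarrow> real" and X :: "'e \<Rightarrow> 'e"
  defines "M \<equiv> \<lambda>x. norm (X x) + (\<Sum>b\<in>Basis. norm (frechet_derivative X (at x) b))"
  assumes "open S" "compact K" "K \<subseteq> S" "K \<noteq> {}"
    and bil: "\<And>x. x \<in> S \<Longrightarrow> bilinear (G x)"
    and sym: "\<And>x v w. x \<in> S \<Longrightarrow> G x v w = G x w v"
    and pos: "\<And>x v. x \<in> S \<Longrightarrow> v \<noteq> 0 \<Longrightarrow> 0 < G x v v"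
    and CG: "\<And>v w. C_k_on 2 S (\<lambda>x. G x v w)"
    and CX: "C_k_on 2 S X"
    and kill: "\<And>x v w. x \<in> S \<Longrightarrow> lie_derivative X G x v w = 0"
  obtains C where "0 \<le> C" "\<And>x z v. x \<in> K \<Longrightarrow> z \<in> Basis \<Longrightarrow> v \<in> Basis \<Longrightarrow>
    norm (frechet_derivative (\<lambda>y. frechet_derivative X (at y) v) (at x) z) \<le> C * M x"
proof -
  define D2X where "D2X v x z = frechet_derivative (\<lambda>y. frechet_derivative X (at y) v) (at x) z" for v x z
  have M0: "M x \<ge> 0" for x
    by (simp add: M_def sum_nonneg)
  have "\<forall>b\<in>Basis \<times> Basis \<times> Basis. \<exists>C\<ge>0. \<forall>x\<in>K.
      \<bar>G x (D2X (fst (snd b)) x (fst b)) (snd (snd b)) + G x (D2X (snd (snd b)) x (fst b)) (fst (snd b))\<bar>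
      \<le> C * M x"
    unfolding D2X_def M_def
    using killing_derivative_bound[OF assms(2-4) bil sym CG CX kill] by auto
  then obtain c where c: "\<And>b. b \<in> Basis \<times> Basis \<times> Basis \<Longrightarrow> c b \<ge> 0 \<and> (\<forall>x\<in>K.
      \<bar>G x (D2X (fst (snd b)) x (fst b)) (snd (snd b)) + G x (D2X (snd (snd b)) x (fst b)) (fst (snd b))\<bar>
      \<le> c b * M x)"
    by metis
  \<comment> \<open>One constant for all basis triples: the sum dominates each of its nonnegative
    terms.\<close>
  define C where "C = sum c (Basis \<times> Basis \<times> Basis)"
  have C0: "C \<ge> 0"
    unfolding C_def using c by (intro sum_nonneg) blast
  have C: "\<bar>G x (D2X v x z) w + G x (D2X w x z) v\<bar> \<le> C * M x"
    if "x \<in> K" "z \<in> Basis" "v \<in> Basis" "w \<in> Basis" for x z v w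
  proof -
    have "c (z, v, w) \<le> C"
      unfolding C_def using c that by (intro member_le_sum) auto
    then have "c (z, v, w) * M x \<le> C * M x"
      using M0 by (intro mult_right_mono)
    moreover have "\<bar>G x (D2X v x z) w + G x (D2X w x z) v\<bar> \<le> c (z, v, w) * M x"
      using c[of "(z, v, w)"] that by simp
    ultimately show ?thesis by linarith
  qed
  have symm: "D2X v x z = D2X z x v" if "x \<in> K" for v x z
    unfolding D2X_def using symmetric_second_derivative[OF assms(2) CX] that assms(4) by blast
  have T: "\<bar>G x (D2X v x z) w\<bar> \<le> 2 * C * M x"
    if x: "x \<in> K" and b: "z \<in> Basis" "v \<in> Basis" "w \<in> Basis" for x z v w
  proof -
    \<comment> \<open>In this combination of three symmetrized expressions, \<open>symm\<close>
      makes four of the six terms cancel. Three bounds \<open>C * M x\<close> give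
      \<open>3/2 * C * M x\<close>, rounded up to \<open>2 * C * M x\<close>.\<close>
    have "2 * G x (D2X v x z) w = (G x (D2X v x z) w + G x (D2X w x z) v)
        + (G x (D2X z x v) w + G x (D2X w x v) z) - (G x (D2X z x w) v + G x (D2X v x w) z)"
      using symm[OF x, of v z] symm[OF x, of w z] symm[OF x, of w v] by simp
    moreover have "C * M x \<ge> 0" using C0 M0 by simp
    ultimately show ?thesis
      using C[OF x b] C[OF x b(2,1,3)] C[OF x b(3,1,2)] by linarith
  qed
  have contG: "continuous_on K (\<lambda>x. G x v w)" for v w
    using CG[of v w] C_k_on_Suc_imp[of 0 S "\<lambda>x. G x v w"] C_k_on_Suc_imp[of 1 S "\<lambda>x. G x v w"] assms(4)
    by (auto simp: numeral_2_eq_2 intro: continuous_on_subset)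
  obtain \<mu> where mu: "0 < \<mu>" "\<And>x v. x \<in> K \<Longrightarrow> \<mu> * norm v \<le> (\<Sum>w\<in>Basis. \<bar>G x v w\<bar>)"
    using metric_lower_bound[OF assms(3,5), of G] bil pos contG assms(4) by blast
  have "norm (D2X v x z) \<le> (DIM('e) * (2 * C) / \<mu>) * M x"
    if x: "x \<in> K" and b: "z \<in> Basis" "v \<in> Basis" for x z v
  proof -
    have "\<mu> * norm (D2X v x z) \<le> (\<Sum>w\<in>Basis. \<bar>G x (D2X v x z) w\<bar>)"
      using mu(2)[OF x] .
    also have "\<dots> \<le> (\<Sum>w\<in>(Basis::'e set). 2 * C * M x)"
      using T[OF x b] by (intro sum_mono)
    finally show ?thesis
      using mu(1) by (simp add: field_simps)
  qed
  moreover have "0 \<le> DIM('e) * (2 * C) / \<mu>"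
    using C0 mu(1) by simp
  ultimately show ?thesis
    using that unfolding D2X_def by blast
qed

text \<open>Convexity keeps the segment from \<open>y\<close> to \<open>z\<close> in
  \<open>K\<close>, and compactness gives one constant along it. The pair of \<open>X\<close> and
  \<open>DX\<close> then satisfies a linear differential inequality with zero initial value.\<close>

lemma killing_field_zero:
  fixes G :: "'e::euclidean_space \<Rightarrow> 'e \<Rightarrow> 'e \<Rightarrow> real" and X :: "'e \<Rightarrow> 'e"
  assumes "open S" "compact K" "convex K" "K \<subseteq> S"
    and bil: "\<And>x. x \<in> S \<Longrightarrow> bilinear (G x)"
    and sym: "\<And>x v w. x \<in> S \<Longrightarrow> G x v w = G x w v"
    and pos: "\<And>x v. x \<in> S \<Longrightarrow> v \<noteq> 0 \<Longrightarrow> 0 < G x v v"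
    and CG: "\<And>v w. C_k_on 2 S (\<lambda>x. G x v w)"
    and CX: "C_k_on 2 S X"
    and kill: "\<And>x v w. x \<in> S \<Longrightarrow> lie_derivative X G x v w = 0"
    and y: "y \<in> K" "X y = 0" "\<And>v. frechet_derivative X (at y) v = 0"
    and z: "z \<in> K"
  shows "X z = 0"
proof -
  define DX where "DX v x = frechet_derivative X (at x) v" for v x
  define D2X where "D2X v x z = frechet_derivative (DX v) (at x) z" for v x z
  define M where "M x = norm (X x) + (\<Sum>b\<in>Basis. norm (DX b x))" for x
  define d where "d = z - y"
  define \<gamma> where "\<gamma> t = y + t *\<^sub>R d" for t :: real
  \<comment> \<open>Squares, because the norms in \<open>M\<close> need not be differentiable where
    they vanish; \<open>\<phi>\<close> and the square of \<open>M\<close> are comparable.\<close>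
  define \<phi> where "\<phi> t = X (\<gamma> t) \<bullet> X (\<gamma> t) + (\<Sum>b\<in>Basis. DX b (\<gamma> t) \<bullet> DX b (\<gamma> t))" for t
  define \<phi>' where "\<phi>' t = 2 * (X (\<gamma> t) \<bullet> DX d (\<gamma> t)) + (\<Sum>b\<in>Basis. 2 * (DX b (\<gamma> t) \<bullet> D2X b (\<gamma> t) d))" for t
  define d1 where "d1 = (\<Sum>b\<in>Basis. \<bar>d \<bullet> b\<bar>)"
  obtain C where C: "0 \<le> C" "\<And>x z v. x \<in> K \<Longrightarrow> z \<in> Basis \<Longrightarrow> v \<in> Basis \<Longrightarrow> norm (D2X v x z) \<le> C * M x"
    unfolding D2X_def DX_def M_def
    using killing_second_derivative_bound[OF assms(1,2,4) _ bil sym pos CG CX kill] y(1) by blast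
  have dX: "(X has_derivative (\<lambda>v. DX v x)) (at x)" if "x \<in> S" for x
    using C_k_on_SucD(1)[of 1 S X x] CX that by (simp add: numeral_2_eq_2 DX_def[abs_def])
  have dDX: "(DX v has_derivative D2X v x) (at x)" if "x \<in> S" for v x
    using C_k_on_SucD(1)[of 0 S "DX v" x] CX that
    by (simp add: D2X_def[abs_def] numeral_2_eq_2 DX_def[abs_def])
  have \<gamma>K: "\<gamma> t \<in> K" if "0 \<le> t" "t \<le> 1" for t
  proof -
    have "\<gamma> t = (1 - t) *\<^sub>R y + t *\<^sub>R z"
      by (simp add: \<gamma>_def d_def algebra_simps)
    then show ?thesis using assms(3) y(1) z that by (simp add: convexD)
  qed
  have chain: "((\<lambda>t. h (\<gamma> t)) has_vector_derivative h' d) (at t)"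
    if "(h has_derivative h') (at (\<gamma> t))" for h :: "'e \<Rightarrow> 'e" and h' t
  proof -
    have "((\<lambda>t. h (\<gamma> t)) has_derivative (\<lambda>r. h' (r *\<^sub>R d))) (at t)"
      by (rule has_derivative_compose[where f=\<gamma> and x=t, OF _ that])
        (auto simp: \<gamma>_def[abs_def] intro!: derivative_eq_intros)
    then show ?thesis
      using linear_scale[OF has_derivative_linear[OF that]] by (simp add: has_vector_derivative_def)
  qed
  have sq: "((\<lambda>t. f t \<bullet> f t) has_real_derivative 2 * (f t \<bullet> f')) (at t)"
    if "(f has_vector_derivative f') (at t)" for f :: "real \<Rightarrow> 'e" and f' t
  proof -
    have "((\<lambda>t. f t \<bullet> f t) has_derivative (\<lambda>r. f t \<bullet> (r *\<^sub>R f') + (r *\<^sub>R f') \<bullet> f t)) (at t)"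
      using that unfolding has_vector_derivative_def by (intro has_derivative_inner)
    then show ?thesis
      unfolding has_field_derivative_def
      by (rule has_derivative_eq_rhs) (auto simp: inner_commute algebra_simps)
  qed
  have "\<phi> 1 \<le> 0"
  proof (rule gronwall_zero)
    fix t :: real assume t: "0 \<le> t" "t \<le> 1"
    have tS: "\<gamma> t \<in> S" and tK: "\<gamma> t \<in> K" using \<gamma>K[OF t] assms(4) by auto
    show "(\<phi> has_real_derivative \<phi>' t) (at t)"
      unfolding \<phi>_def \<phi>'_def
      by (intro DERIV_add DERIV_sum sq chain dX[OF tS] dDX[OF tS])
    let ?m = "M (\<gamma> t)"
    have M0: "0 \<le> ?m"
      by (simp add: M_def sum_nonneg)
    have d1: "0 \<le> d1"
      by (simp add: d1_def sum_nonneg)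
    have DXle: "norm (DX b (\<gamma> t)) \<le> ?m" if "b \<in> Basis" for b
      unfolding M_def by (rule add_increasing) (use that in \<open>auto intro: member_le_sum\<close>)
    have "norm (DX d (\<gamma> t)) \<le> d1 * ?m"
      unfolding d1_def
      by (rule norm_linear_le_sum_Basis[OF has_derivative_linear[OF dX[OF tS]] DXle])
    then have "X (\<gamma> t) \<bullet> DX d (\<gamma> t) \<le> norm (X (\<gamma> t)) * (d1 * ?m)"
      by (meson mult_left_mono norm_cauchy_schwarz norm_ge_zero order_trans)
    moreover have "DX b (\<gamma> t) \<bullet> D2X b (\<gamma> t) d \<le> norm (DX b (\<gamma> t)) * (d1 * (C * ?m))" if "b \<in> Basis" for b
    proof -
      have "norm (D2X b (\<gamma> t) d) \<le> d1 * (C * ?m)"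
        unfolding d1_def
        by (rule norm_linear_le_sum_Basis[OF has_derivative_linear[OF dDX[OF tS]] C(2)[OF tK _ that]])
      then show ?thesis
        by (meson mult_left_mono norm_cauchy_schwarz norm_ge_zero order_trans)
    qed
    ultimately have "\<phi>' t \<le> 2 * (norm (X (\<gamma> t)) * (d1 * ?m))
        + (\<Sum>b\<in>Basis. 2 * (norm (DX b (\<gamma> t)) * (d1 * (C * ?m))))"
      unfolding \<phi>'_def by (intro add_mono mult_left_mono sum_mono) auto
    also have "\<dots> = 2 * d1 * ?m * (norm (X (\<gamma> t)) + C * (\<Sum>b\<in>Basis. norm (DX b (\<gamma> t))))"
      by (simp add: algebra_simps sum_distrib_left)
    also have "\<dots> \<le> 2 * d1 * ?m * ((1 + C) * ?m)"
    proof (rule mult_left_mono)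
      show "norm (X (\<gamma> t)) + C * (\<Sum>b\<in>Basis. norm (DX b (\<gamma> t))) \<le> (1 + C) * ?m"
        using C(1) by (simp add: M_def algebra_simps sum_nonneg)
    qed (use d1 M0 in simp)
    also have "\<dots> = 2 * d1 * (1 + C) * ?m\<^sup>2"
      by (simp add: power2_eq_square)
    \<comment> \<open>The factor \<open>2 * (1 + DIM('e))\<close> comes from (a + b)^2 \<le> 2 a^2 +
      2 b^2 and from the Cauchy-Schwarz inequality for a sum of \<open>DIM('e)\<close>
      terms.\<close>
    also have "\<dots> \<le> 2 * d1 * (1 + C) * (2 * (1 + DIM('e)) * \<phi> t)"
    proof (rule mult_left_mono)
      have "?m\<^sup>2 \<le> 2 * (norm (X (\<gamma> t)))\<^sup>2 + 2 * (\<Sum>b\<in>Basis. norm (DX b (\<gamma> t)))\<^sup>2"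
        unfolding M_def power2_sum
        using sum_squares_bound[of "norm (X (\<gamma> t))" "\<Sum>b\<in>Basis. norm (DX b (\<gamma> t))"] by linarith
      also have "\<dots> \<le> 2 * (norm (X (\<gamma> t)))\<^sup>2 + 2 * ((\<Sum>b\<in>Basis. (norm (DX b (\<gamma> t)))\<^sup>2) * DIM('e))"
        using sum_squared_le_sum_of_squares[of "\<lambda>b. norm (DX b (\<gamma> t))" Basis] by simp
      also have "\<dots> \<le> 2 * (1 + DIM('e)) * ((norm (X (\<gamma> t)))\<^sup>2 + (\<Sum>b\<in>Basis. (norm (DX b (\<gamma> t)))\<^sup>2))"
        by (simp add: algebra_simps sum_nonneg)
      also have "\<dots> = 2 * (1 + DIM('e)) * \<phi> t"
        by (simp add: \<phi>_def power2_norm_eq_inner)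
      finally show "?m\<^sup>2 \<le> 2 * (1 + DIM('e)) * \<phi> t" .
    qed (use d1 C(1) in simp)
    finally show "\<phi>' t \<le> (2 * d1 * (1 + C) * (2 * (1 + DIM('e)))) * \<phi> t"
      by (simp add: mult.assoc)
  next
    show "\<phi> 0 = 0"
      using y(2,3) by (simp add: \<phi>_def \<gamma>_def DX_def)
  qed
  then have "X (\<gamma> 1) \<bullet> X (\<gamma> 1) \<le> 0"
    unfolding \<phi>_def by (smt (verit) inner_ge_zero sum_nonneg)
  then show ?thesis
    by (simp add: \<gamma>_def d_def flip: power2_norm_eq_inner)
qed

text \<open>The hypersurface is the graph of \<open>\<tau>\<close>. Since \<open>DX\<close> vanishes on its tangent space, testing the
  equation there gives \<open>c = 0\<close>, and then the skew endomorphism \<open>DX\<close> has rank at most one.\<close>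

lemma homothety_zero_on_graph:
  fixes G :: "'e::euclidean_space \<times> real \<Rightarrow> 'e \<times> real \<Rightarrow> 'e \<times> real \<Rightarrow> real"
    and X :: "'e \<times> real \<Rightarrow> 'e \<times> real" and \<tau> :: "'e \<Rightarrow> real"
  assumes "open V" "x \<in> V"
    and tau: "\<tau> differentiable (at x)"
    and zero: "\<And>y. y \<in> V \<Longrightarrow> X (y, \<tau> y) = 0"
    and bil: "bilinear (G (x, \<tau> x))"
    and sym: "\<And>v w. G (x, \<tau> x) v w = G (x, \<tau> x) w v"
    and pos: "\<And>v. v \<noteq> 0 \<Longrightarrow> 0 < G (x, \<tau> x) v v"
    and dG: "\<And>v w. (\<lambda>p. G p v w) differentiable (at (x, \<tau> x))"
    and dX: "X differentiable (at (x, \<tau> x))"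
    and hom: "\<And>v w. c * G (x, \<tau> x) v w + 1/2 * lie_derivative X G (x, \<tau> x) v w = 0"
  shows "c = 0" "frechet_derivative X (at (x, \<tau> x)) v = 0"
proof -
  let ?p = "(x, \<tau> x)"
  define B where "B = G ?p"
  define DX where "DX = frechet_derivative X (at ?p)"
  have DX: "(X has_derivative DX) (at ?p)"
    using dX by (simp add: DX_def frechet_derivative_works)
  interpret DX: linear DX
    using DX by (rule has_derivative_linear)
  obtain \<tau>' where tau': "(\<tau> has_derivative \<tau>') (at x)"
    using tau by (auto simp: differentiable_def)
  have "((\<lambda>y. X (y, \<tau> y)) has_derivative (\<lambda>v. DX (v, \<tau>' v))) (at x)"
    by (rule has_derivative_compose[where f="\<lambda>y. (y, \<tau> y)" and x=x, OF _ DX])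
      (intro has_derivative_Pair has_derivative_ident tau')
  moreover have "((\<lambda>y. X (y, \<tau> y)) has_derivative (\<lambda>v. 0)) (at x)"
    by (rule has_derivative_transform_within_open[OF has_derivative_const[of 0] assms(1,2)]) (simp add: zero)
  ultimately have tangent: "DX (v, \<tau>' v) = 0" for v
    using has_derivative_unique by metis
  \<comment> \<open>As \<open>X\<close> vanishes at \<open>?p\<close>, the term that differentiates
    \<open>G\<close> along \<open>X\<close> drops out, and the equation becomes algebraic in
    \<open>DX\<close>.\<close>
  have lie: "lie_derivative X G ?p v w = B (DX v) w + B v (DX w)" for v w
    using linear_0[OF frechet_derivative_linear[OF dG]] zero[OF assms(2)]
    by (simp add: lie_derivative_def B_def DX_def)
  have eq: "c * B v w + 1/2 * (B (DX v) w + B v (DX w)) = 0" for v w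
    using hom[of v w] unfolding lie B_def .
  have linB: "linear (B v)" "linear (\<lambda>v. B v w)" for v w
    using bil unfolding bilinear_def B_def by blast+
  obtain e :: 'e where e: "e \<in> Basis"
    using nonempty_Basis by blast
  show "c = 0"
  proof -
    \<comment> \<open>A nonzero vector tangent to the graph. \<open>DX\<close> kills it, so testing
      with it leaves \<open>c\<close> times a positive number.\<close>
    have "(e, \<tau>' e) \<noteq> 0"
      using e by (auto simp: zero_prod_def)
    then have "B (e, \<tau>' e) (e, \<tau>' e) > 0"
      using pos by (simp add: B_def)
    then show ?thesis
      using eq[of "(e, \<tau>' e)" "(e, \<tau>' e)"] linear_0[OF linB(1)] linear_0[OF linB(2)]
      by (simp add: tangent)
  qed
  then have skew: "B (DX v) w + B v (DX w) = 0" for v w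
    using eq[of v w] by simp
  \<comment> \<open>The vertical direction is transverse to every graph, so together with the
    tangent vectors it spans the space.\<close>
  define n :: "'e \<times> real" where "n = (0, 1)"
  have decomp: "w = (fst w, \<tau>' (fst w)) + (snd w - \<tau>' (fst w)) *\<^sub>R n" for w :: "'e \<times> real"
    by (simp add: n_def prod_eq_iff)
  \<comment> \<open>The pairing with \<open>n\<close> vanishes by skewness and symmetry; skewness
    moves the pairing with a tangent vector to one with its image under \<open>DX\<close>, which is
    0. Taking \<open>w = DX n\<close> then gives \<open>DX n = 0\<close>.\<close>
  have "B (DX n) w = 0" for w
  proof -
    have "B (DX n) n = 0"
      using skew[of n n] sym[of n "DX n"] by (simp add: B_def)
    moreover have "B (DX n) (fst w, \<tau>' (fst w)) = 0"
      using skew[of n "(fst w, \<tau>' (fst w))"] linear_0[OF linB(1)] by (simp add: tangent)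
    ultimately show ?thesis
      using linear_add[OF linB(1)] linear_scale[OF linB(1)] decomp[of w]
      by (metis add_0 scale_zero_right)
  qed
  then have "DX n = 0"
    using pos[of "DX n"] unfolding B_def by (metis less_irrefl)
  then have "DX v = 0"
    using decomp[of v] tangent DX.add DX.scale by (metis add_0 scale_zero_right)
  then show "frechet_derivative X (at ?p) v = 0"
    by (simp add: DX_def)
qed

section \<open>Charts, product charts and the Gibbons--Hawking metric\<close>

lemma is_chart_inj: "is_chart c \<Longrightarrow> inj_on (snd c) (fst c)"
  unfolding is_chart_def homeomorphism_def by (metis inj_on_def)

lemma chart_inv_chart: "is_chart c \<Longrightarrow> q \<in> fst c \<Longrightarrow> chart_inv c (snd c q) = q"
  by (simp add: chart_inv_def is_chart_inj)

lemma chart_inv_mem: "x \<in> chart_image c \<Longrightarrow> chart_inv c x \<in> fst c"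
  by (simp add: chart_inv_def inv_into_into)

lemma chart_chart_inv: "x \<in> chart_image c \<Longrightarrow> snd c (chart_inv c x) = x"
  by (simp add: chart_inv_def f_inv_into_f)

lemma open_chart_image: "is_chart c \<Longrightarrow> open (chart_image c)"
  by (simp add: is_chart_def)

lemma open_chart_image_Int:
  assumes "is_chart c" "open V"
  shows "open (snd c ` (fst c \<inter> V))"
proof -
  obtain \<psi> where h: "homeomorphism (fst c) (chart_image c) (snd c) \<psi>" and op: "open (chart_image c)"
    using assms(1) by (auto simp: is_chart_def)
  have "openin (top_of_set (chart_image c)) (snd c ` (fst c \<inter> V))"
    using homeomorphism_imp_open_map[OF h] assms(2) by blast
  then show ?thesis using op openin_open_trans by blast
qed

lemma open_chart_preimage:
  assumes "is_chart c" "open W"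
  shows "open (fst c \<inter> snd c -` W)"
  using assms by (metis continuous_open_preimage homeomorphism_def is_chart_def)

lemma transition_chart: "is_chart c \<Longrightarrow> p \<in> fst c \<Longrightarrow> transition c d (snd c p) = snd d p"
  by (simp add: transition_def chart_inv_chart)

lemma transition_differentiable:
  assumes "is_chart c" "is_chart d" "smooth_compatible c d" "p \<in> fst c" "p \<in> fst d"
  shows "transition c d differentiable (at (snd c p))"
proof -
  have "C_k_on (Suc 0) (snd c ` (fst c \<inter> fst d)) (transition c d)"
    using assms(3) by (simp add: smooth_compatible_def smooth_on_def del: C_k_on.simps)
  then show ?thesis using assms(4,5) by auto
qed

lemma has_derivative_change_chart:
  assumes c: "is_chart c" and d: "is_chart d" and comp: "smooth_compatible c d"
    and p: "p \<in> fst c" "p \<in> fst d"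
    and D: "(f \<circ> chart_inv d has_derivative D) (at (snd d p))"
  shows "(f \<circ> chart_inv c has_derivative D \<circ> frechet_derivative (transition c d) (at (snd c p)))
    (at (snd c p))"
proof -
  let ?W = "snd c ` (fst c \<inter> fst d)"
  have "(transition c d has_derivative frechet_derivative (transition c d) (at (snd c p))) (at (snd c p))"
    using transition_differentiable[OF c d comp p] by (simp add: frechet_derivative_works)
  from diff_chain_at[OF this D[folded transition_chart[OF c p(1), of d]]]
  show ?thesis
  proof (rule has_derivative_transform_within_open)
    show "open ?W"
      using open_chart_image_Int[OF c] d by (simp add: is_chart_def)
    show "snd c p \<in> ?W" using p by blast
    show "((f \<circ> chart_inv d) \<circ> transition c d) x = (f \<circ> chart_inv c) x" if "x \<in> ?W" for x
      using that by (auto simp: transition_def chart_inv_chart[OF c] chart_inv_chart[OF d])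
  qed
qed

text \<open>\<open>d_fun\<close> differentiates in a chart picked by \<open>SOME\<close>; the chain
  rule carries the computation to the chart \<open>c\<close>, where the derivative is known.
  Differentiability in the picked chart is first transported from \<open>c\<close>. The hypothesis
  compares charts with \<open>c\<close> only, which for a product chart \<open>c\<close> is exactly
  what membership in \<open>product_structure\<close> says.\<close>

lemma d_fun_coord_vector:
  assumes c: "c \<in> \<M>" "is_chart c" "p \<in> fst c"
    and compat: "\<And>d. d \<in> \<M> \<Longrightarrow> is_chart d \<and> smooth_compatible d c"
    and D: "(f \<circ> chart_inv c has_derivative D) (at (snd c p))"
  shows "d_fun \<M> f p (coord_vector \<M> c p v) = D v"
proof -
  define d where "d = (SOME d. d \<in> \<M> \<and> p \<in> fst d)"
  have d: "d \<in> \<M>" "p \<in> fst d"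
    using c someI[of "\<lambda>d. d \<in> \<M> \<and> p \<in> fst d" c] by (auto simp: d_def)
  note dc = compat[OF d(1)]
  have cd: "smooth_compatible c d"
    using dc by (simp add: smooth_compatible_def inf_commute)
  define D' where "D' = frechet_derivative (f \<circ> chart_inv d) (at (snd d p))"
  have "f \<circ> chart_inv d differentiable (at (snd d p))"
    using has_derivative_change_chart[OF conjunct1[OF dc] c(2) conjunct2[OF dc] d(2) c(3) D]
    by (auto simp: differentiable_def)
  then have "(f \<circ> chart_inv d has_derivative D') (at (snd d p))"
    by (simp add: D'_def frechet_derivative_works)
  from has_derivative_change_chart[OF c(2) conjunct1[OF dc] cd c(3) d(2) this]
  have "D = D' \<circ> frechet_derivative (transition c d) (at (snd c p))"
    using D has_derivative_unique by blast
  then show ?thesis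
    using d by (simp add: d_fun_def coord_vector_def Let_def flip: d_def D'_def)
qed

text \<open>The Jacobian rule determines all other components, and the default value 0 settles the
  remaining arguments. Equality of vector fields at a point can thus be tested in a single product
  chart.\<close>

lemma tangent_space_eqI:
  assumes "v \<in> tangent_space \<M> p" "w \<in> tangent_space \<M> p" "c \<in> \<M>" "p \<in> fst c" "v c = w c"
  shows "v = w"
proof
  fix d
  have "x d = (if d \<in> \<M> \<and> p \<in> fst d
      then frechet_derivative (transition c d) (at (snd c p)) (x c) else 0)"
    if "x \<in> tangent_space \<M> p" for x
    using bspec[OF bspec[OF conjunct1[OF that[unfolded tangent_space_def mem_Collect_eq]] assms(3)], of d]
      conjunct2[OF that[unfolded tangent_space_def mem_Collect_eq]] assms(4)
    by (cases "d \<in> \<M> \<and> p \<in> fst d") (simp_all only: Int_iff simp_thms if_True if_False, blast+)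
  from this[OF assms(1)] this[OF assms(2)] show "v d = w d"
    by (simp only: assms(5))
qed

section \<open>Product charts\<close>

lemma fst_prod_chart [simp]: "fst (prod_chart c) = fst c \<times> UNIV"
  by (simp add: prod_chart_def)

lemma snd_prod_chart [simp]: "snd (prod_chart c) p = (snd c (fst p), snd p)"
  by (simp add: prod_chart_def case_prod_beta)

lemma prod_chart_image_Int:
  "snd (prod_chart c) ` (fst (prod_chart c) \<inter> fst (prod_chart d)) = snd c ` (fst c \<inter> fst d) \<times> UNIV"
  by force

lemma prod_chart_image: "chart_image (prod_chart c) = chart_image c \<times> UNIV"
  using prod_chart_image_Int[of c c] by simp

lemma chart_inv_prod_chart:
  assumes "is_chart c" "x \<in> chart_image c"
  shows "chart_inv (prod_chart c) (x, t) = (chart_inv c x, t)"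
  unfolding chart_inv_def[of "prod_chart c"]
proof (rule inv_into_f_eq)
  show "inj_on (snd (prod_chart c)) (fst (prod_chart c))"
    using is_chart_inj[OF assms(1)] by (auto simp: inj_on_def)
qed (use assms in \<open>auto simp: chart_inv_mem chart_chart_inv\<close>)

lemma is_chart_prod_chart:
  assumes "is_chart c"
  shows "is_chart (prod_chart c)"
proof -
  obtain \<psi> where h: "homeomorphism (fst c) (chart_image c) (snd c) \<psi>"
    and op: "open (fst c)" "open (chart_image c)"
    using assms by (auto simp: is_chart_def)
  have cont: "continuous_on (fst c) (snd c)" "continuous_on (chart_image c) \<psi>"
    using h by (auto simp: homeomorphism_def)
  have "homeomorphism (fst c \<times> UNIV) (chart_image c \<times> UNIV) (snd (prod_chart c))
      (\<lambda>p. (\<psi> (fst p), snd p))"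
  proof (rule homeomorphismI)
    show "continuous_on (fst c \<times> UNIV) (snd (prod_chart c))"
      by (simp, intro continuous_on_Pair continuous_on_snd[OF continuous_on_id]
          continuous_on_compose2[OF cont(1) continuous_on_fst[OF continuous_on_id]]) auto
    show "continuous_on (chart_image c \<times> UNIV) (\<lambda>p. (\<psi> (fst p), snd p))"
      by (intro continuous_on_Pair continuous_on_snd[OF continuous_on_id]
          continuous_on_compose2[OF cont(2) continuous_on_fst[OF continuous_on_id]]) auto
  qed (use h in \<open>auto simp: homeomorphism_def\<close>)
  then show ?thesis
    using op unfolding is_chart_def prod_chart_image by (auto intro: open_Times)
qed

lemma smooth_on_transition_prod_chart:
  assumes c: "is_chart c" and d: "is_chart d" and "smooth_on (snd c ` (fst c \<inter> fst d)) (transition c d)"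
  shows "smooth_on (snd (prod_chart c) ` (fst (prod_chart c) \<inter> fst (prod_chart d)))
    (transition (prod_chart c) (prod_chart d))"
  unfolding smooth_on_def prod_chart_image_Int
proof
  fix k
  let ?W = "snd c ` (fst c \<inter> fst d)"
  have op: "open ?W"
    using open_chart_image_Int[OF c] d by (simp add: is_chart_def)
  have "C_k_on k (?W \<times> UNIV) (\<lambda>p. (transition c d (fst p), snd p :: real))"
  proof (rule C_k_on_Pair)
    show "C_k_on k (?W \<times> UNIV) (\<lambda>p. transition c d (fst p))"
      using assms(3) by (intro C_k_on_fst op) (simp add: smooth_on_def)
  qed (auto intro: open_Times op C_k_on_bounded_linear bounded_linear_snd)
  then show "C_k_on k (?W \<times> UNIV) (transition (prod_chart c) (prod_chart d))"
  proof (rule C_k_on_cong[THEN iffD1, rotated 2])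
    show "(transition c d (fst p), snd p) = transition (prod_chart c) (prod_chart d) p"
      if "p \<in> ?W \<times> UNIV" for p
      using that chart_inv_prod_chart[OF c, of "fst p" "snd p"] by (auto simp: transition_def)
  qed (auto intro: open_Times op)
qed

lemma smooth_structure_chartD: "smooth_structure \<S> \<Longrightarrow> c \<in> \<S> \<Longrightarrow> is_chart c"
  by (auto simp: smooth_structure_def)

lemma smooth_structure_compatibleD:
  "smooth_structure \<S> \<Longrightarrow> c \<in> \<S> \<Longrightarrow> d \<in> \<S> \<Longrightarrow> smooth_compatible c d"
  by (auto simp: smooth_structure_def)

lemma smooth_structure_coverD: "smooth_structure \<S> \<Longrightarrow> \<exists>c\<in>\<S>. q \<in> fst c"
  by (auto simp: smooth_structure_def)

lemma prod_chart_in_product_structure: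
  assumes "smooth_structure \<S>" "c \<in> \<S>"
  shows "prod_chart c \<in> product_structure \<S>"
proof -
  note ch = smooth_structure_chartD[OF assms(1)] and comp = smooth_structure_compatibleD[OF assms(1)]
  have "smooth_compatible (prod_chart c) (prod_chart d)" if d: "d \<in> \<S>" for d
    using smooth_on_transition_prod_chart[OF ch[OF assms(2)] ch[OF d]] comp[OF assms(2) d]
      smooth_on_transition_prod_chart[OF ch[OF d] ch[OF assms(2)]] comp[OF d assms(2)]
    unfolding smooth_compatible_def by (metis Int_commute)
  then show ?thesis
    using is_chart_prod_chart[OF ch[OF assms(2)]] by (simp add: product_structure_def)
qed

text \<open>In a product chart the differentials of the projection and of \<open>t\<close> are the
  two coordinate projections. The coefficients of the metric therefore do not depend on
  \<open>t\<close>.\<close>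

lemma gibbons_hawking_metric_in_prod_chart:
  assumes S: "smooth_structure \<S>" and c: "c \<in> \<S>" and x: "x \<in> chart_image c"
  shows "tensor_in_chart (product_structure \<S>) (prod_chart c) (gibbons_hawking_metric \<S> h u A) (x, t) v w
    = u (chart_inv c x) * tensor_in_chart \<S> c h x (fst v) (fst w)
    + inverse (u (chart_inv c x)) *
      ((snd v + form_in_chart \<S> c A x (fst v)) * (snd w + form_in_chart \<S> c A x (fst w)))"
proof -
  let ?M = "product_structure \<S>" and ?P = "prod_chart c"
  note ch = smooth_structure_chartD[OF S c]
  define q where "q = chart_inv c x"
  have q: "q \<in> fst c" "snd c q = x"
    using x by (simp_all add: q_def chart_inv_mem chart_chart_inv)
  have PM: "?P \<in> ?M" "is_chart ?P" "(q, t) \<in> fst ?P"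
    using prod_chart_in_product_structure[OF S c] is_chart_prod_chart[OF ch] q by auto
  have compat: "is_chart d \<and> smooth_compatible d ?P" if "d \<in> ?M" for d
    using that c by (simp add: product_structure_def)
  have op: "open (chart_image c \<times> (UNIV :: real set))"
    using open_chart_image[OF ch] by (intro open_Times) auto
  have xt: "(x, t) \<in> chart_image c \<times> UNIV" using x by simp
  have snd_coord: "d_fun ?M snd (q, t) (coord_vector ?M ?P (q, t) v) = snd v" for v
  proof (rule d_fun_coord_vector[OF PM compat])
    show "(snd \<circ> chart_inv ?P has_derivative snd) (at (snd ?P (q, t)))"
      unfolding snd_prod_chart fst_conv snd_conv q(2)
      by (rule has_derivative_transform_within_open[OF has_derivative_snd[OF has_derivative_ident] op xt])
        (auto simp: chart_inv_prod_chart[OF ch])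
  qed
  \<comment> \<open>Compared in each chart \<open>d\<close> of the base: in coordinates
    \<open>snd d \<circ> fst\<close> is the transition from \<open>c\<close> to \<open>d\<close>
    after \<open>fst\<close>, and \<open>coord_vector\<close> is defined by the derivative of that
    transition.\<close>
  have fst_coord: "pushforward ?M \<S> fst (q, t) (coord_vector ?M ?P (q, t) v) = coord_vector \<S> c q (fst v)" for v
  proof
    fix d
    show "pushforward ?M \<S> fst (q, t) (coord_vector ?M ?P (q, t) v) d = coord_vector \<S> c q (fst v) d"
    proof (cases "d \<in> \<S> \<and> q \<in> fst d")
      case True
      have T: "(transition c d has_derivative frechet_derivative (transition c d) (at x)) (at x)"
        using transition_differentiable[OF ch smooth_structure_chartD[OF S, of d]
            smooth_structure_compatibleD[OF S c, of d], of q] True q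
        by (simp add: frechet_derivative_works)
      have "d_fun ?M (snd d \<circ> fst) (q, t) (coord_vector ?M ?P (q, t) v)
          = (\<lambda>v. frechet_derivative (transition c d) (at x) (fst v)) v"
      proof (rule d_fun_coord_vector[OF PM compat])
        have "((\<lambda>p. transition c d (fst p)) has_derivative
            (\<lambda>v. frechet_derivative (transition c d) (at x) (fst v))) (at (x, t))"
          by (rule has_derivative_compose[where f=fst and x="(x, t)"])
            (auto intro: has_derivative_fst[OF has_derivative_ident] T)
        from has_derivative_transform_within_open[OF this op xt]
        show "((snd d \<circ> fst) \<circ> chart_inv ?P has_derivative
            (\<lambda>v. frechet_derivative (transition c d) (at x) (fst v))) (at (snd ?P (q, t)))"
          unfolding snd_prod_chart fst_conv snd_conv q(2)
          by (auto simp: chart_inv_prod_chart[OF ch] transition_def)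
      qed
      then show ?thesis
        using True q(2) by (simp add: pushforward_def coord_vector_def)
    qed (auto simp: pushforward_def coord_vector_def)
  qed
  show ?thesis
    by (simp add: tensor_in_chart_def gibbons_hawking_metric_def Let_def chart_inv_prod_chart[OF ch x]
        snd_coord fst_coord form_in_chart_def flip: q_def)
qed

text \<open>Supplies the hypotheses on \<open>G\<close> for \<open>homothety_zero_on_graph\<close>
  and \<open>killing_field_zero\<close>. In product charts the explicit formula reduces all of them
  to properties of \<open>h\<close>, \<open>u\<close> and \<open>A\<close>.\<close>

lemma gibbons_hawking_metric_chart_properties:
  fixes \<S> :: "('n::{second_countable_topology,t2_space}, real^3) chart set"
  assumes data: "gibbons_hawking_data \<S> \<O> h u A" and c: "c \<in> \<S>"
  defines "G \<equiv> tensor_in_chart (product_structure \<S>) (prod_chart c) (gibbons_hawking_metric \<S> h u A)"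
  shows "p \<in> chart_image (prod_chart c) \<Longrightarrow> bilinear (G p)"
    and "p \<in> chart_image (prod_chart c) \<Longrightarrow> G p v w = G p w v"
    and "p \<in> chart_image (prod_chart c) \<Longrightarrow> v \<noteq> 0 \<Longrightarrow> 0 < G p v v"
    and "C_k_on k (chart_image (prod_chart c)) (\<lambda>p. G p v w)"
proof -
  have S: "smooth_structure \<S>" and h: "riemannian_metric \<S> h" and u: "smooth_function \<S> u"
    and upos: "\<And>q. 0 < u q" and A: "smooth_one_form \<S> A"
    using data by (auto simp: gibbons_hawking_data_def)
  let ?h = "tensor_in_chart \<S> c h" and ?A = "form_in_chart \<S> c A" and ?u = "\<lambda>x. u (chart_inv c x)"
  have G: "G p v w = ?u (fst p) * ?h (fst p) (fst v) (fst w)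
      + inverse (?u (fst p)) * ((snd v + ?A (fst p) (fst v)) * (snd w + ?A (fst p) (fst w)))"
    if "p \<in> chart_image (prod_chart c)" for p v w
    using gibbons_hawking_metric_in_prod_chart[OF S c, of "fst p" h u A "snd p" v w] that
    unfolding G_def prod_chart_image by (auto simp: mem_Times_iff)
  have hx: "bilinear (?h x)" "?h x a b = ?h x b a" "a \<noteq> 0 \<Longrightarrow> 0 < ?h x a a" "linear (?A x)"
    if "x \<in> chart_image c" for x a b
    using h A c that by (auto simp: riemannian_metric_def smooth_one_form_def)
  {
    assume p: "p \<in> chart_image (prod_chart c)"
    then have x: "fst p \<in> chart_image c" by (auto simp: prod_chart_image)
    have linh: "linear (?h (fst p) a)" "linear (\<lambda>a. ?h (fst p) a b)" for a b
      using hx(1)[OF x] by (auto simp: bilinear_def)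
    note simps = linear_add[OF linh(1)] linear_add[OF linh(2)] linear_scale[OF linh(1)]
      linear_scale[OF linh(2)] linear_add[OF hx(4)[OF x]] linear_scale[OF hx(4)[OF x]]
    show "bilinear (G p)"
      unfolding bilinear_def G[OF p] by (auto intro!: linearI simp: simps algebra_simps)
    show "G p v w = G p w v"
      unfolding G[OF p] using hx(2)[OF x] by (simp add: mult.commute)
    show "0 < G p v v" if "v \<noteq> 0"
    proof (cases "fst v = 0")
      \<comment> \<open>For a vertical vector the \<open>h\<close> term is 0 and the connection form
        reduces to \<open>snd v\<close>; for any other vector the \<open>h\<close> term alone is
        positive.\<close>
      case True
      then have "snd v \<noteq> 0" using that by (simp add: prod_eq_iff)
      then show ?thesis
        using upos linear_0[OF hx(4)[OF x]] linear_0[OF linh(1)] True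
        by (auto simp: G[OF p] zero_less_mult_iff linorder_neq_iff)
    next
      case False
      then have "0 < ?u (fst p) * ?h (fst p) (fst v) (fst v)"
        using upos hx(3)[OF x] by simp
      moreover have "0 \<le> inverse (?u (fst p)) * ((snd v + ?A (fst p) (fst v)) * (snd v + ?A (fst p) (fst v)))"
        using upos[of "chart_inv c (fst p)"] by simp
      ultimately show ?thesis unfolding G[OF p] by linarith
    qed
  }
  have op: "open (chart_image c)"
    using open_chart_image smooth_structure_chartD[OF S c] by blast
  have opP: "open (chart_image c \<times> (UNIV :: real set))"
    using op by (intro open_Times) auto
  have unz: "u q \<noteq> 0" for q
    using upos[of q] by simp
  have pull: "C_k_on k (chart_image c \<times> UNIV) (\<lambda>p :: (real^3) \<times> real. f (fst p))"
    if "smooth_on (chart_image c) f" for f :: "real^3 \<Rightarrow> real"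
    using that by (intro C_k_on_fst op) (simp add: smooth_on_def)
  have "C_k_on k (chart_image c \<times> UNIV) (\<lambda>p :: (real^3) \<times> real. ?u (fst p) * ?h (fst p) (fst v) (fst w)
      + inverse (?u (fst p)) * ((snd v + ?A (fst p) (fst v)) * (snd w + ?A (fst p) (fst w))))"
    using u h A c unz
    by (intro C_k_on_add C_k_on_mult C_k_on_inverse C_k_on_const opP pull)
      (auto simp: smooth_function_def riemannian_metric_def smooth_one_form_def comp_def)
  then show "C_k_on k (chart_image (prod_chart c)) (\<lambda>p. G p v w)"
    unfolding prod_chart_image
    by (rule C_k_on_cong[OF opP, THEN iffD1, rotated]) (rule G[symmetric], simp only: prod_chart_image)
qed

section \<open>Uniqueness of soliton flows\<close>

theorem theorem3p1:
  fixes \<S> \<O> \<A> :: "('n::{second_countable_topology,t2_space}, real^3) chart set"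
    and h :: "('n, real^3) two_tensor"
    and u :: "'n \<Rightarrow> real"
    and A :: "('n, real^3) one_form"
    and \<M> \<B> :: "('n \<times> real, (real^3) \<times> real) chart set"
    and g :: "('n \<times> real, (real^3) \<times> real) two_tensor"
    and E E' :: "('n \<times> real, (real^3) \<times> real) vector_field"
    and U :: "'n set"
    and s :: "'n \<Rightarrow> 'n \<times> real"
  assumes "gibbons_hawking_data \<S> \<O> h u A"
    and "real_analytic_atlas \<S> h \<A>"
    and "\<M> = product_structure \<S>"
    and "g = gibbons_hawking_metric \<S> h u A"
    and "real_analytic_atlas \<M> g \<B>"
    and "soliton_flow \<M> g E" and "real_analytic_vector_field \<B> E"
    and "soliton_flow \<M> g E'" and "real_analytic_vector_field \<B> E'"
    and "open U" and "U \<noteq> {}"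
    and "smooth_map_on \<S> \<M> U s" and "\<forall>p\<in>U. fst (s p) = p"
    and "\<forall>p\<in>U. E (s p) = E' (s p)"
  shows "E = E'"
proof -
  have S: "smooth_structure \<S>" and conn: "connected (UNIV :: 'n set)"
    using assms(1) by (auto simp: gibbons_hawking_data_def)
  note ch = smooth_structure_chartD[OF S]

  \<comment> \<open>The difference field in product charts\<close>
  define G where "G c = tensor_in_chart \<M> (prod_chart c) g" for c
  define X where "X c x = vector_in_chart (prod_chart c) E x - vector_in_chart (prod_chart c) E' x" for c x
  define D where "D c = chart_image (prod_chart c)" for c :: "('n, real^3) chart"
  have PM: "prod_chart c \<in> \<M>" if "c \<in> \<S>" for c
    unfolding assms(3) by (rule prod_chart_in_product_structure[OF S that])
  have chP: "is_chart (prod_chart c)" if "c \<in> \<S>" for c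
    by (rule is_chart_prod_chart[OF ch[OF that]])
  have opD: "open (D c)" if "c \<in> \<S>" for c
    unfolding D_def by (rule open_chart_image[OF chP[OF that]])
  note Gp = gibbons_hawking_metric_chart_properties[OF assms(1), folded assms(3,4), folded G_def D_def]
  have dG: "(\<lambda>x. G c x v w) differentiable (at x)" if "c \<in> \<S>" "x \<in> D c" for c v w x
    using Gp(4)[OF that(1), of "Suc 0" v w] that(2) by simp
  have E: "smooth_on (D c) (vector_in_chart (prod_chart c) E)"
    "smooth_on (D c) (vector_in_chart (prod_chart c) E')" if "c \<in> \<S>" for c
    using assms(6,8) PM[OF that] unfolding soliton_flow_def smooth_vector_field_def D_def by blast+
  have CX: "C_k_on k (D c) (X c)" if "c \<in> \<S>" for c k
    using E[OF that] unfolding X_def smooth_on_def by (intro C_k_on_diff opD that) auto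
  have dX: "X c differentiable (at x)" if "c \<in> \<S>" "x \<in> D c" for c x
    using CX[OF that(1), of "Suc 0"] that(2) by simp
  obtain a where a: "\<And>c x v w. c \<in> \<S> \<Longrightarrow> x \<in> D c \<Longrightarrow> ricci (G c) x v w + a * G c x v w
      + 1/2 * lie_derivative (vector_in_chart (prod_chart c) E) (G c) x v w = 0"
    using assms(6) PM unfolding soliton_flow_def G_def D_def by meson
  obtain a' where a': "\<And>c x v w. c \<in> \<S> \<Longrightarrow> x \<in> D c \<Longrightarrow> ricci (G c) x v w + a' * G c x v w
      + 1/2 * lie_derivative (vector_in_chart (prod_chart c) E') (G c) x v w = 0"
    using assms(8) PM unfolding soliton_flow_def G_def D_def by meson
  \<comment> \<open>The Ricci terms of the two soliton equations are identical and cancel. The two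
    constants may still differ, so the difference is at this stage only known to be
    homothetic.\<close>
  have hom: "(a - a') * G c x v w + 1/2 * lie_derivative (X c) (G c) x v w = 0"
    if "c \<in> \<S>" "x \<in> D c" for c x v w
  proof -
    have "vector_in_chart (prod_chart c) E differentiable (at x)"
      "vector_in_chart (prod_chart c) E' differentiable (at x)"
      using E[OF that(1)] that(2) unfolding smooth_on_def by (metis C_k_on.simps(2))+
    then show ?thesis
      unfolding X_def[abs_def] using a[OF that, of v w] a'[OF that, of v w]
      by (simp add: lie_derivative_diff dG[OF that] Gp(1)[OF that] algebra_simps)
  qed
  have X_iff: "X c (snd (prod_chart c) p) = 0 \<longleftrightarrow> E p = E' p" if "c \<in> \<S>" "fst p \<in> fst c" for c p
  proof -
    have p: "p \<in> fst (prod_chart c)" using that by (simp add: mem_Times_iff)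
    have "E p \<in> tangent_space \<M> p" "E' p \<in> tangent_space \<M> p"
      using assms(6,8) unfolding soliton_flow_def smooth_vector_field_def by blast+
    then show ?thesis
      using tangent_space_eqI[OF _ _ PM[OF that(1)] p] chart_inv_chart[OF chP[OF that(1)] p]
      unfolding X_def vector_in_chart_def by auto
  qed

  \<comment> \<open>First-order vanishing at a point of the hypersurface\<close>
  obtain q where q: "q \<in> U" using assms(11) by blast
  obtain c where c: "c \<in> \<S>" "q \<in> fst c" using smooth_structure_coverD[OF S] by blast
  define V where "V = snd c ` (fst c \<inter> U)"
  define \<tau> where "\<tau> x = snd (s (chart_inv c x))" for x
  have opV: "open V"
    unfolding V_def by (rule open_chart_image_Int[OF ch[OF c(1)] assms(10)])
  have graph: "s r = (r, \<tau> (snd c r))" if "r \<in> fst c" "r \<in> U" for r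
    using assms(13) that by (simp add: \<tau>_def chart_inv_chart[OF ch[OF c(1)]] prod_eq_iff)
  have qV: "snd c q \<in> V" using c q by (auto simp: V_def)
  \<comment> \<open>Over \<open>fst c\<close> a section stays in the domain of
    \<open>prod_chart c\<close>, so the smoothness of \<open>s\<close> in these two charts holds on
    all of \<open>V\<close>; the last component of the coordinate expression is
    \<open>\<tau>\<close>.\<close>
  have "U \<inter> fst c \<inter> s -` fst (prod_chart c) = fst c \<inter> U"
    using assms(13) by (auto simp: mem_Times_iff)
  then have "smooth_on V (snd (prod_chart c) \<circ> s \<circ> chart_inv c)"
    using assms(12) c(1) PM[OF c(1)] unfolding smooth_map_on_def V_def by metis
  then have "C_k_on (Suc 0) V (snd (prod_chart c) \<circ> s \<circ> chart_inv c)"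
    unfolding smooth_on_def by blast
  from C_k_on_linear_compose[OF opV this bounded_linear_snd]
  have "C_k_on (Suc 0) V \<tau>"
    by (simp add: \<tau>_def[abs_def] comp_def del: C_k_on.simps)
  then have d\<tau>: "\<tau> differentiable (at (snd c q))"
    using qV by simp
  define y where "y = (snd c q, \<tau> (snd c q))"
  have yD: "y \<in> D c"
    using c unfolding y_def D_def prod_chart_image by blast
  have X0: "X c (x, \<tau> x) = 0" if x: "x \<in> V" for x
  proof -
    obtain r where r: "r \<in> fst c" "r \<in> U" "x = snd c r" using x by (auto simp: V_def)
    show ?thesis
      using X_iff[OF c(1), of "s r"] bspec[OF assms(14) r(2)] r graph[OF r(1,2)] by simp
  qed
  note rigid = homothety_zero_on_graph[where V=V and x="snd c q" and \<tau>=\<tau> and X="X c" and G="G c" and c="a - a'",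
      folded y_def, OF opV qV d\<tau> X0 Gp(1)[OF c(1) yD] Gp(2)[OF c(1) yD] Gp(3)[OF c(1) yD]
        dG[OF c(1) yD] dX[OF c(1) yD] hom[OF c(1) yD]]
  \<comment> \<open>The constants \<open>a\<close> and \<open>a'\<close> belong to the whole
    manifold, so equality found at the single point \<open>y\<close> gives the Killing equation in
    every product chart.\<close>
  have aa: "a - a' = 0" and DX0: "\<And>v. frechet_derivative (X c) (at y) v = 0"
    using rigid by auto
  \<comment> \<open>The centre \<open>y0\<close> of the ball and the point \<open>y\<close> where
    \<open>X\<close> and \<open>DX\<close> vanish are kept apart: in the closure argument the ball
    is centred at a limit point, while the vanishing is known only at a nearby point.\<close>
  have propagate: "E p = E' p"
    if c: "c \<in> \<S>" and sub: "cball y0 r \<subseteq> D c" and y: "y \<in> cball y0 r" "X c y = 0"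
      "\<And>v. frechet_derivative (X c) (at y) v = 0"
      and p: "p \<in> fst (prod_chart c)" "snd (prod_chart c) p \<in> cball y0 r" for c y0 r y p
  proof -
    have "X c (snd (prod_chart c) p) = 0"
    proof (rule killing_field_zero[OF opD[OF c] compact_cball convex_cball sub Gp(1-3)[OF c] Gp(4)[OF c] CX[OF c] _ y p(2)])
      show "lie_derivative (X c) (G c) x v w = 0" if "x \<in> D c" for x v w
        using hom[OF c that, of v w] aa by simp
    qed auto
    then show ?thesis
      using X_iff[OF c, of p] p(1) by (auto simp: mem_Times_iff)
  qed

  \<comment> \<open>The interior rather than the whole coincidence set: propagation starts from
    \<open>X = 0\<close> together with \<open>DX = 0\<close>, and the second follows from the first
    on an open set.\<close>
  define Z where "Z = interior {p. E p = E' p}"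
  have "Z = UNIV"
  proof -
    have "s q \<in> Z"
    proof -
      obtain r where r: "r > 0" "cball y r \<subseteq> D c"
        using opD[OF c(1)] yD open_contains_cball by blast
      have "open (fst (prod_chart c) \<inter> snd (prod_chart c) -` ball y r)"
        by (rule open_chart_preimage[OF chP[OF c(1)] open_ball])
      moreover have "fst (prod_chart c) \<inter> snd (prod_chart c) -` ball y r \<subseteq> {p. E p = E' p}"
        using propagate[OF c(1) r(2), of y] r(1) X0[OF qV] DX0 by (auto simp: y_def)
      moreover have "s q \<in> fst (prod_chart c) \<inter> snd (prod_chart c) -` ball y r"
        using graph[OF c(2) q] c(2) r(1) by (simp add: y_def)
      ultimately show ?thesis
        unfolding Z_def by (meson interiorI)
    qed
    moreover have "closure Z \<subseteq> Z"
    proof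
      fix p assume p: "p \<in> closure Z"
      obtain c where c: "c \<in> \<S>" "fst p \<in> fst c" using smooth_structure_coverD[OF S] by blast
      let ?P = "prod_chart c"
      have pP: "p \<in> fst ?P" using c by (simp add: mem_Times_iff)
      then have "snd ?P p \<in> D c" unfolding D_def by blast
      then obtain r where r: "r > 0" "cball (snd ?P p) r \<subseteq> D c"
        using opD[OF c(1)] open_contains_cball by blast
      define N where "N = fst ?P \<inter> snd ?P -` ball (snd ?P p) r"
      have opN: "open N"
        unfolding N_def by (rule open_chart_preimage[OF chP[OF c(1)] open_ball])
      have pN: "p \<in> N" using pP r(1) by (simp add: N_def)
      then obtain p1 where p1: "p1 \<in> N" "p1 \<in> Z"
        using p opN by (metis IntE disjoint_iff open_Int_closure_eq_empty)
      define W where "W = snd ?P ` (fst ?P \<inter> Z)"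
      have opW: "open W"
        unfolding W_def Z_def by (rule open_chart_image_Int[OF chP[OF c(1)] open_interior])
      have XW: "X c x = 0" if x: "x \<in> W" for x
      proof -
        obtain p' where "p' \<in> fst ?P" "p' \<in> Z" "x = snd ?P p'" using x unfolding W_def by blast
        then show ?thesis
          using X_iff[OF c(1), of p'] interior_subset unfolding Z_def by (auto simp: mem_Times_iff)
      qed
      have y1: "snd ?P p1 \<in> W" using p1 unfolding W_def N_def by blast
      have "frechet_derivative (X c) (at (snd ?P p1)) = frechet_derivative (\<lambda>x. 0) (at (snd ?P p1))"
        by (rule frechet_derivative_cong_open[OF opW y1 XW])
      then have "frechet_derivative (X c) (at (snd ?P p1)) v = 0" for v
        by simp
      then have "N \<subseteq> {p. E p = E' p}"
        using propagate[OF c(1) r(2), of "snd ?P p1"] XW[OF y1] p1(1) by (auto simp: N_def)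
      then show "p \<in> Z"
        unfolding Z_def using opN pN by (meson interiorI)
    qed
    then have "closed Z"
      using closure_subset closure_closed by (metis subset_antisym closed_closure)
    moreover have "connected (UNIV :: ('n \<times> real) set)"
      using connected_Times[OF conn, of "UNIV :: real set"] by simp
    moreover have "open Z" by (simp add: Z_def)
    ultimately show ?thesis
      unfolding connected_clopen by (metis empty_iff open_openin closed_closedin subtopology_UNIV)
  qed
  then have "E p = E' p" for p
    using interior_subset unfolding Z_def by blast
  then show ?thesis ..
qed

end
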